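(* Let $D$ be a decidable domain presented by a language $L$, let $L^{+}$ adjoin the parametrised gate $\mathrm{ask}(\cdot)$, and let $(a_k)_{k\in\mathbb{N}}$ be the iterates. Suppose $|Q^{*}(p)|=n<\infty$. Then the sequence $(a_k(p))_{k\in\mathbb{N}}$ is eventually periodic, with transient plus period at most $2^n$; the eventual period is computable from $\nu(p)$; and the bound is essentially attained: for infinitely many $n$ there is a system $\nu(p)$ of the re-entry language (with the parametrised gate adjoined) with $|Q^{*}(p)|=n$ whose sequence $(a_k(p))_k$ has period $2^n-1$.
   Context: A domain $D$ presented by a language $L$ with a computable numbering of its systems has a manifestation predicate; it is decidable if it is decidable whether a given system manifests. $L^{+}$ is obtained from $L$ by adjoining a gate $\mathrm{ask}(q)$ with a parameter $q\in\mathbb{N}$; $L^+$ is a decidable set of finite syntactic objects with a fixed computable numbering $\nu:\mathbb{N}\to L^{+}$ extending that of $L$. Assigning a value in $\{0,1\}=\{\text{void},\text{mark}\}$ to every occurring gate turns a system of $L^+$ into a gate-free system of $L$, which is evaluated as in $L$. Iterates: $a_0(p)=0$ for all $p$; $a_{k+1}(p)=1$ if the system $\nu(p)$, evaluated with each occurrence of $\mathrm{ask}(q)$ returning $a_k(q)$, fails to manifest, and $a_{k+1}(p)=0$ otherwise. $Q(p)=\{q:\mathrm{ask}(q)\text{ occurs in }\nu(p)\}$, and $Q^{*}(p)$ is the closure of $\{p\}$ under $Q$ (the smallest set containing $p$ and containing $Q(q)$ whenever it contains $q$). Re-entry language: over $\{\text{void},\text{mark}\}=\{0,1\}$, crossing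 is negation and juxtaposition is disjunction. A (finite-state) re-entry system consists of finitely many state variables, each updated synchronously by an expression built from the state variables by crossing and juxtaposition, evolving from its initial state, with one designated observed coordinate; it manifests iff the observed coordinate takes the value mark at some time. In $L^{+}$ the expressions may additionally contain gates $\mathrm{ask}(q)$. This domain is decidable. *)

theory Defs
  imports Main "HOL-Library.Nat_Bijection"
begin

section \<open>Partial recursive functions\<close>

text \<open>
  Partial recursive functions of one argument; several arguments are passed through the Cantor
  pairing \<^const>\<open>prod_encode\<close>.  \<open>None\<close> means divergence.
\<close>

primrec prec_iter :: "(nat \<Rightarrow> nat option) \<Rightarrow> (nat \<Rightarrow> nat option) \<Rightarrow> nat \<Rightarrow> nat \<Rightarrow> nat option" where
  "prec_iter f g a 0 = f a"
| "prec_iter f g a (Suc n) =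
     Option.bind (prec_iter f g a n) (\<lambda>r. g (prod_encode (a, prod_encode (n, r))))"

definition is_mu :: "(nat \<Rightarrow> nat option) \<Rightarrow> nat \<Rightarrow> nat \<Rightarrow> bool" where
  "is_mu f a n \<longleftrightarrow>
     f (prod_encode (a, n)) = Some 0 \<and>
     (\<forall>m<n. \<exists>v. f (prod_encode (a, m)) = Some v \<and> v > 0)"

inductive partrec :: "(nat \<Rightarrow> nat option) \<Rightarrow> bool" where
  zero:  "partrec (\<lambda>x. Some 0)"
| succ:  "partrec (\<lambda>x. Some (Suc x))"
| left:  "partrec (\<lambda>x. Some (fst (prod_decode x)))"
| right: "partrec (\<lambda>x. Some (snd (prod_decode x)))"
| pair:  "partrec f \<Longrightarrow> partrec g \<Longrightarrow>
            partrec (\<lambda>x. Option.bind (f x) (\<lambda>u. Option.bind (g x) (\<lambda>v. Some (prod_encode (u, v)))))"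
| comp:  "partrec f \<Longrightarrow> partrec g \<Longrightarrow> partrec (\<lambda>x. Option.bind (g x) f)"
| prec:  "partrec f \<Longrightarrow> partrec g \<Longrightarrow>
            partrec (\<lambda>x. prec_iter f g (fst (prod_decode x)) (snd (prod_decode x)))"
| mu:    "partrec f \<Longrightarrow>
            partrec (\<lambda>a. if \<exists>n. is_mu f a n then Some (THE n. is_mu f a n) else None)"

definition computable :: "(nat \<Rightarrow> nat) \<Rightarrow> bool" where
  "computable f \<longleftrightarrow> partrec (\<lambda>x. Some (f x))"

definition decidable_set :: "nat set \<Rightarrow> bool" where
  "decidable_set A \<longleftrightarrow> computable (\<lambda>x. if x \<in> A then 1 else 0)"


section \<open>Domains and the parametrised gate\<close>

text \<open>
  The systems of \<open>L\<close> and \<open>L\<^sup>+\<close> are finite syntactic objects of type \<open>'s\<close>, with an injective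
  Goedel coding \<open>goedel\<close>.  The set \<open>gates s\<close> collects the parameters \<open>q\<close> of the gates
  \<open>ask(q)\<close> occurring in \<open>s\<close>, and \<open>fill s \<alpha>\<close> is the gate-free system obtained from \<open>s\<close> by
  replacing each occurrence of \<open>ask(q)\<close> by the value \<open>\<alpha> q\<close> (mark = \<open>True\<close>, void = \<open>False\<close>).
\<close>

record 's domain_pres =
  goedel    :: "'s \<Rightarrow> nat"
  sys       :: "'s set"            \<comment> \<open>\<open>L\<close>\<close>
  num       :: "nat \<Rightarrow> 's"         \<comment> \<open>the numbering of \<open>L\<close>\<close>
  manifests :: "'s \<Rightarrow> bool"        \<comment> \<open>only meaningful on \<open>L\<close>\<close>
  sysp      :: "'s set"            \<comment> \<open>\<open>L\<^sup>+\<close>\<close>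
  nump      :: "nat \<Rightarrow> 's"         \<comment> \<open>\<open>\<nu>\<close>, the numbering of \<open>L\<^sup>+\<close>\<close>
  gates     :: "'s \<Rightarrow> nat set"
  fill      :: "'s \<Rightarrow> (nat \<Rightarrow> bool) \<Rightarrow> 's"

definition computable_numbering :: "('s \<Rightarrow> nat) \<Rightarrow> 's set \<Rightarrow> (nat \<Rightarrow> 's) \<Rightarrow> bool" where
  "computable_numbering c X \<nu> \<longleftrightarrow> range \<nu> = X \<and> computable (\<lambda>i. c (\<nu> i))"

text \<open>
  Both numberings have domain \<open>\<nat>\<close>, so \<open>\<nu>\<close> extends the numbering of \<open>L\<close> up to a computable
  translation of indices.
\<close>

definition extends_numbering :: "(nat \<Rightarrow> 's) \<Rightarrow> (nat \<Rightarrow> 's) \<Rightarrow> bool" where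
  "extends_numbering \<nu> \<mu> \<longleftrightarrow> (\<exists>e. computable e \<and> (\<forall>i. \<nu> (e i) = \<mu> i))"

text \<open>
  The last two clauses say that reading off the gates of a system and substituting values for
  them are effective operations on the syntax; a finite set of parameters is given by its
  canonical index \<^const>\<open>set_encode\<close>, and the assignment is given by the set of parameters that
  receive mark.
\<close>

definition presentation :: "'s domain_pres \<Rightarrow> bool" where
  "presentation D \<longleftrightarrow>
     inj_on (goedel D) (sysp D) \<and>
     decidable_set (goedel D ` sysp D) \<and>
     computable_numbering (goedel D) (sys D) (num D) \<and>
     computable_numbering (goedel D) (sysp D) (nump D) \<and>
     extends_numbering (nump D) (num D) \<and>
     sys D = {s \<in> sysp D. gates D s = {}} \<and>
     (\<forall>s\<in>sysp D. finite (gates D s)) \<and>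
     (\<forall>s\<in>sysp D. \<forall>\<alpha>. fill D s \<alpha> \<in> sys D) \<and>
     (\<forall>s\<in>sys D. \<forall>\<alpha>. fill D s \<alpha> = s) \<and>
     (\<forall>s\<in>sysp D. \<forall>\<alpha> \<beta>. (\<forall>q\<in>gates D s. \<alpha> q = \<beta> q) \<longrightarrow> fill D s \<alpha> = fill D s \<beta>) \<and>
     (\<exists>g. computable g \<and> (\<forall>s\<in>sysp D. g (goedel D s) = set_encode (gates D s))) \<and>
     (\<exists>h. computable h \<and>
        (\<forall>s\<in>sysp D. \<forall>A. finite A \<longrightarrow>
           h (prod_encode (goedel D s, set_encode A)) = goedel D (fill D s (\<lambda>q. q \<in> A))))"

definition decidable_domain :: "'s domain_pres \<Rightarrow> bool" where
  "decidable_domain D \<longleftrightarrow>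
     presentation D \<and> decidable_set (goedel D ` {s \<in> sys D. manifests D s})"

primrec iterate :: "'s domain_pres \<Rightarrow> nat \<Rightarrow> nat \<Rightarrow> bool" where
  "iterate D 0 = (\<lambda>p. False)"
| "iterate D (Suc k) = (\<lambda>p. \<not> manifests D (fill D (nump D p) (iterate D k)))"

definition asks :: "'s domain_pres \<Rightarrow> nat \<Rightarrow> nat set" where
  "asks D p = gates D (nump D p)"

inductive_set asks_closure :: "'s domain_pres \<Rightarrow> nat \<Rightarrow> nat set" for D p where
  base: "p \<in> asks_closure D p"
| step: "q \<in> asks_closure D p \<Longrightarrow> r \<in> asks D q \<Longrightarrow> r \<in> asks_closure D p"


section \<open>Eventually periodic sequences\<close>

definition is_eventual_period :: "(nat \<Rightarrow> 'a) \<Rightarrow> nat \<Rightarrow> bool" where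
  "is_eventual_period x P \<longleftrightarrow> P > 0 \<and> (\<exists>T. \<forall>k\<ge>T. x (k + P) = x k)"

definition eventually_periodic :: "(nat \<Rightarrow> 'a) \<Rightarrow> bool" where
  "eventually_periodic x \<longleftrightarrow> (\<exists>P. is_eventual_period x P)"

definition eventual_period :: "(nat \<Rightarrow> 'a) \<Rightarrow> nat" where
  "eventual_period x = (LEAST P. is_eventual_period x P)"

definition transient :: "(nat \<Rightarrow> 'a) \<Rightarrow> nat" where
  "transient x = (LEAST T. \<forall>k\<ge>T. x (k + eventual_period x) = x k)"


section \<open>The re-entry language\<close>

text \<open>The empty expression is void; mark is the crossing of void.\<close>

datatype rexpr = Void | Var nat | Cross rexpr | Juxt rexpr rexpr | Ask nat

text \<open>Update expressions, initial state, observed coordinate.\<close>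

datatype rsystem = RSys (updates: "rexpr list") (initial: "bool list") (observed: nat)

primrec rexpr_vars :: "rexpr \<Rightarrow> nat set" where
  "rexpr_vars Void = {}"
| "rexpr_vars (Var i) = {i}"
| "rexpr_vars (Cross e) = rexpr_vars e"
| "rexpr_vars (Juxt e f) = rexpr_vars e \<union> rexpr_vars f"
| "rexpr_vars (Ask q) = {}"

primrec rexpr_gates :: "rexpr \<Rightarrow> nat set" where
  "rexpr_gates Void = {}"
| "rexpr_gates (Var i) = {}"
| "rexpr_gates (Cross e) = rexpr_gates e"
| "rexpr_gates (Juxt e f) = rexpr_gates e \<union> rexpr_gates f"
| "rexpr_gates (Ask q) = {q}"

primrec rexpr_fill :: "(nat \<Rightarrow> bool) \<Rightarrow> rexpr \<Rightarrow> rexpr" where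
  "rexpr_fill \<alpha> Void = Void"
| "rexpr_fill \<alpha> (Var i) = Var i"
| "rexpr_fill \<alpha> (Cross e) = Cross (rexpr_fill \<alpha> e)"
| "rexpr_fill \<alpha> (Juxt e f) = Juxt (rexpr_fill \<alpha> e) (rexpr_fill \<alpha> f)"
| "rexpr_fill \<alpha> (Ask q) = (if \<alpha> q then Cross Void else Void)"

text \<open>Evaluation concerns gate-free expressions only; the value at a gate is a dummy.\<close>

primrec rexpr_eval :: "(nat \<Rightarrow> bool) \<Rightarrow> rexpr \<Rightarrow> bool" where
  "rexpr_eval \<sigma> Void = False"
| "rexpr_eval \<sigma> (Var i) = \<sigma> i"
| "rexpr_eval \<sigma> (Cross e) = (\<not> rexpr_eval \<sigma> e)"
| "rexpr_eval \<sigma> (Juxt e f) = (rexpr_eval \<sigma> e \<or> rexpr_eval \<sigma> f)"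
| "rexpr_eval \<sigma> (Ask q) = False"

primrec rexpr_code :: "rexpr \<Rightarrow> nat" where
  "rexpr_code Void = prod_encode (0, 0)"
| "rexpr_code (Var i) = prod_encode (1, i)"
| "rexpr_code (Cross e) = prod_encode (2, rexpr_code e)"
| "rexpr_code (Juxt e f) = prod_encode (3, prod_encode (rexpr_code e, rexpr_code f))"
| "rexpr_code (Ask q) = prod_encode (4, q)"

definition rsys_code :: "rsystem \<Rightarrow> nat" where
  "rsys_code s =
     prod_encode (list_encode (map rexpr_code (updates s)),
       prod_encode (list_encode (map of_bool (initial s)), observed s))"

definition rsys_wf :: "rsystem \<Rightarrow> bool" where
  "rsys_wf s \<longleftrightarrow>
     length (initial s) = length (updates s) \<and>
     observed s < length (updates s) \<and>
     (\<forall>e\<in>set (updates s). \<forall>i\<in>rexpr_vars e. i < length (updates s))"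

definition rsys_gates :: "rsystem \<Rightarrow> nat set" where
  "rsys_gates s = (\<Union>e\<in>set (updates s). rexpr_gates e)"

definition rsys_fill :: "rsystem \<Rightarrow> (nat \<Rightarrow> bool) \<Rightarrow> rsystem" where
  "rsys_fill s \<alpha> = RSys (map (rexpr_fill \<alpha>) (updates s)) (initial s) (observed s)"

primrec rsys_state :: "rsystem \<Rightarrow> nat \<Rightarrow> bool list" where
  "rsys_state s 0 = initial s"
| "rsys_state s (Suc t) = map (rexpr_eval (\<lambda>i. rsys_state s t ! i)) (updates s)"

definition rsys_manifests :: "rsystem \<Rightarrow> bool" where
  "rsys_manifests s \<longleftrightarrow> (\<exists>t. rsys_state s t ! observed s)"

text \<open>
  The numberings are left as parameters.  Whether systems can ask about each other in a cycle
  depends on \<open>\<nu>\<close>: if, say, \<open>q < p\<close> whenever \<open>ask(q)\<close> occurs in \<open>\<nu>(p)\<close>, there are no cycles and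
  every sequence of iterates is eventually constant.
\<close>

definition reentry :: "(nat \<Rightarrow> rsystem) \<Rightarrow> (nat \<Rightarrow> rsystem) \<Rightarrow> rsystem domain_pres" where
  "reentry \<mu> \<nu> =
     \<lparr> goedel = rsys_code,
       sys = {s. rsys_wf s \<and> rsys_gates s = {}},
       num = \<mu>,
       manifests = rsys_manifests,
       sysp = {s. rsys_wf s},
       nump = \<nu>,
       gates = rsys_gates,
       fill = rsys_fill \<rparr>"

end

theory Submission
  imports Defs
begin

text \<open>
  On a finite set closed under asking the iterates form a deterministic sequence of subsets, so the
  pigeonhole principle bounds transient plus period by \<open>2 ^ n\<close>.  The period is found by two
  searches: for an index of the given code together with a closed set \<open>X\<close> containing it, then for
  the least shift that preserves the sequence on a window that starts after the transient and covers
  a full period; \<open>Suc (set_encode X) \<ge> 2 ^ card X\<close> serves as start and length of the window.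

  For the lower bound, \<open>n\<close> one-variable systems that ask about each other implement an \<open>n\<close>-bit binary
  counter with end-around carry, \<open>0, 1, \<dots>, 2 ^ n - 1, 1, 2, \<dots>\<close>.  Its top bit has a single block of
  zeros and a single block of ones per round, hence no period shorter than \<open>2 ^ n - 1\<close>.
\<close>

text \<open>The period has to be computed from the code of a system, whereas gates name indices, so
  nothing can be simulated before some index of the system is known. Neither search has to find a
  canonical object. Any index with the given code will do: \<open>goedel\<close> is injective on
  \<open>sysp\<close>, and an iterate depends on its index only through the system numbered by it.
  Any finite set closed under asking will do as well, since it determines its own evolution; a set
  larger than the closure only lengthens the window. The end-around carry skips 0 after the start.
  The initial all-void state is thus pure transient, and one transient step plus the period
  \<open>2 ^ n - 1\<close> meets the bound exactly; a plain counter would return to 0 and have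
  period \<open>2 ^ n\<close>. Decidability of the re-entry domain is shown from the bare definition
  of \<open>partrec\<close>. Operations on expressions recurse on trees, while
  \<open>partrec\<close> offers only recursion on numbers, which is why course-of-values recursion
  on codes is developed.\<close>

section \<open>Computable functions\<close>

abbreviation pfst :: "nat \<Rightarrow> nat" where "pfst x \<equiv> fst (prod_decode x)"
abbreviation psnd :: "nat \<Rightarrow> nat" where "psnd x \<equiv> snd (prod_decode x)"

named_theorems computable_intros

text \<open>Kept out of \<open>computable_intros\<close>, because its conclusion unifies with every
  computability goal; it is always instantiated at a known outer function.\<close>

lemma computable_comp:
  assumes "computable f" "computable g"
  shows "computable (\<lambda>x. f (g x))"
  using partrec.comp[of "\<lambda>x. Some (f x)" "\<lambda>x. Some (g x)"] assms by (simp add: computable_def)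

lemma computable_prod_encode [computable_intros]:
  assumes "computable f" "computable g"
  shows "computable (\<lambda>x. prod_encode (f x, g x))"
  using partrec.pair[of "\<lambda>x. Some (f x)" "\<lambda>x. Some (g x)"] assms by (simp add: computable_def)

lemma computable_pfst [computable_intros]: "computable f \<Longrightarrow> computable (\<lambda>x. pfst (f x))"
  by (rule computable_comp) (simp add: computable_def partrec.left)

lemma computable_psnd [computable_intros]: "computable f \<Longrightarrow> computable (\<lambda>x. psnd (f x))"
  by (rule computable_comp) (simp add: computable_def partrec.right)

lemma computable_Suc [computable_intros]: "computable f \<Longrightarrow> computable (\<lambda>x. Suc (f x))"
  by (rule computable_comp) (simp add: computable_def partrec.succ)

text \<open>The identity is not a generator of \<open>partrec\<close>; it arises by pairing the two
  projections.\<close>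

lemma computable_id [computable_intros]: "computable (\<lambda>x. x)"
proof -
  have "computable (\<lambda>x. prod_encode (pfst x, psnd x))"
    using partrec.left partrec.right by (intro computable_prod_encode) (auto simp: computable_def)
  then show ?thesis by simp
qed

lemma computable_const [computable_intros]: "computable (\<lambda>x. c)"
  by (induction c) (auto simp: computable_def intro: partrec.zero computable_Suc[unfolded computable_def])

lemma computable_comp2:
  assumes "computable (\<lambda>z. F (pfst z) (psnd z))" "computable f" "computable g"
  shows "computable (\<lambda>x. F (f x) (g x))"
  using computable_comp[OF assms(1) computable_prod_encode[OF assms(2,3)]] by simp

lemma computable_comp3:
  assumes F: "computable (\<lambda>z. F (pfst z) (pfst (psnd z)) (psnd (psnd z)))"
    and fgh: "computable f" "computable g" "computable h"
  shows "computable (\<lambda>x. F (f x) (g x) (h x))"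
proof -
  have "computable (\<lambda>x. prod_encode (f x, prod_encode (g x, h x)))"
    by (intro computable_prod_encode fgh)
  from computable_comp[OF F this] show ?thesis by simp
qed

text \<open>The whole argument \<open>x\<close> is passed as the parameter of
  \<open>prec_iter\<close>, so base and step may both depend on it. The nested projections in the
  second premise follow the argument layout of \<open>prec_iter\<close>.\<close>

lemma computable_rec_nat [computable_intros]:
  assumes f: "computable f"
    and g: "computable (\<lambda>z. g (pfst z) (pfst (psnd z)) (psnd (psnd z)))"
    and n: "computable n"
  shows "computable (\<lambda>x. rec_nat (f x) (g x) (n x))"
proof -
  let ?g = "\<lambda>z. g (pfst z) (pfst (psnd z)) (psnd (psnd z))"
  have iter: "prec_iter (\<lambda>x. Some (f x)) (\<lambda>x. Some (?g x)) a k = Some (rec_nat (f a) (g a) k)" for a k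
    by (induction k) auto
  have "computable (\<lambda>z. rec_nat (f (pfst z)) (g (pfst z)) (psnd z))"
    using partrec.prec[OF f[unfolded computable_def] g[unfolded computable_def]]
    unfolding iter computable_def .
  from computable_comp2[OF this computable_id n] show ?thesis .
qed

lemma computable_add [computable_intros]:
  assumes "computable f" "computable g" shows "computable (\<lambda>x. f x + g x)"
proof -
  have "rec_nat a (\<lambda>_ r. Suc r) b = a + b" for a b :: nat by (induction b) auto
  moreover have "computable (\<lambda>x. rec_nat (f x) (\<lambda>_ r. Suc r) (g x))"
    by (intro computable_intros assms)
  ultimately show ?thesis by simp
qed

lemma computable_mult [computable_intros]:
  assumes "computable f" "computable g" shows "computable (\<lambda>x. f x * g x)"
proof -
  have "rec_nat 0 (\<lambda>_ r. r + a) b = a * b" for a b :: nat by (induction b) auto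
  moreover have "computable (\<lambda>x. rec_nat 0 (\<lambda>_ r. r + f x) (g x))"
    by (intro computable_intros assms computable_comp[OF assms(1)])
  ultimately show ?thesis by simp
qed

lemma computable_power [computable_intros]:
  assumes "computable f" "computable g" shows "computable (\<lambda>x. f x ^ g x)"
proof -
  have "rec_nat 1 (\<lambda>_ r. r * a) b = a ^ b" for a b :: nat by (induction b) auto
  moreover have "computable (\<lambda>x. rec_nat 1 (\<lambda>_ r. r * f x) (g x))"
    by (intro computable_intros assms computable_comp[OF assms(1)])
  ultimately show ?thesis by simp
qed

lemma computable_diff [computable_intros]:
  assumes "computable f" "computable g" shows "computable (\<lambda>x. f x - g x)"
proof -
  \<comment> \<open>The predecessor: the step returns its index and forgets the accumulator.
    Iterating it gives truncated subtraction.\<close>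
  have pred: "computable (\<lambda>x. rec_nat 0 (\<lambda>i _. i) x)" by (intro computable_intros)
  have "rec_nat a (\<lambda>_ r. rec_nat 0 (\<lambda>i _. i) r) b = a - b" for a b :: nat
  proof (induction b)
    case (Suc b)
    have "rec_nat 0 (\<lambda>i _. i) r = r - 1" for r :: nat by (cases r) auto
    with Suc show ?case by simp
  qed simp
  moreover have "computable (\<lambda>x. rec_nat (f x) (\<lambda>_ r. rec_nat 0 (\<lambda>i _. i) r) (g x))"
    by (intro computable_intros assms computable_comp[OF pred])
  ultimately show ?thesis by simp
qed

lemma computable_sum:
  assumes f: "computable (\<lambda>z. f (pfst z) (psnd z))" and n: "computable n"
  shows "computable (\<lambda>x. \<Sum>i<n x. f x i)"
proof -
  have "rec_nat 0 (\<lambda>i r. r + f x i) k = (\<Sum>i<k. f x i)" for x k by (induction k) auto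
  moreover have "computable (\<lambda>x. rec_nat 0 (\<lambda>i r. r + f x i) (n x))"
    by (intro computable_intros computable_comp2[OF f] n)
  ultimately show ?thesis by simp
qed

section \<open>Decidable predicates, bounded quantifiers and finite sets given by canonical
  index\<close>

definition computable_pred :: "(nat \<Rightarrow> bool) \<Rightarrow> bool" where
  "computable_pred P \<longleftrightarrow> computable (\<lambda>x. of_bool (P x))"

lemma decidable_set_iff: "decidable_set A \<longleftrightarrow> computable_pred (\<lambda>x. x \<in> A)"
  by (simp add: decidable_set_def computable_pred_def of_bool_def)

lemma computable_of_bool [computable_intros]:
  "computable_pred P \<Longrightarrow> computable (\<lambda>x. of_bool (P x))"
  by (simp add: computable_pred_def)

lemma computable_pred_comp:
  "computable_pred P \<Longrightarrow> computable f \<Longrightarrow> computable_pred (\<lambda>x. P (f x))"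
  unfolding computable_pred_def by (rule computable_comp)

lemma computable_pred_comp2:
  assumes "computable_pred (\<lambda>z. P (pfst z) (psnd z))" "computable f" "computable g"
  shows "computable_pred (\<lambda>x. P (f x) (g x))"
  using assms unfolding computable_pred_def by (rule computable_comp2)

lemma computable_if [computable_intros]:
  assumes "computable_pred P" "computable f" "computable g"
  shows "computable (\<lambda>x. if P x then f x else g x)"
proof -
  have "computable (\<lambda>x. of_bool (P x) * f x + (1 - of_bool (P x)) * g x)"
    by (intro computable_intros assms)
  moreover have "of_bool (P x) * f x + (1 - of_bool (P x)) * g x = (if P x then f x else g x)" for x
    by simp
  ultimately show ?thesis by simp
qed

lemma computable_pred_le [computable_intros]:
  assumes "computable f" "computable g" shows "computable_pred (\<lambda>x. f x \<le> g x)"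
proof -
  have "computable (\<lambda>x. 1 - (f x - g x))" by (intro computable_intros assms)
  moreover have "1 - (f x - g x) = of_bool (f x \<le> g x)" for x by auto
  ultimately show ?thesis unfolding computable_pred_def by simp
qed

lemma computable_pred_not [computable_intros]:
  assumes "computable_pred P" shows "computable_pred (\<lambda>x. \<not> P x)"
proof -
  have "computable (\<lambda>x. 1 - of_bool (P x))" by (intro computable_intros assms)
  moreover have "1 - of_bool (P x) = (of_bool (\<not> P x) :: nat)" for x by auto
  ultimately show ?thesis unfolding computable_pred_def by simp
qed

lemma computable_pred_conj [computable_intros]:
  assumes "computable_pred P" "computable_pred Q" shows "computable_pred (\<lambda>x. P x \<and> Q x)"
proof -
  have "computable (\<lambda>x. of_bool (P x) * of_bool (Q x))" by (intro computable_intros assms)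
  then show ?thesis unfolding computable_pred_def of_bool_conj .
qed

lemma computable_pred_disj [computable_intros]:
  assumes "computable_pred P" "computable_pred Q" shows "computable_pred (\<lambda>x. P x \<or> Q x)"
proof -
  have "computable_pred (\<lambda>x. \<not> (\<not> P x \<and> \<not> Q x))" by (intro computable_intros assms)
  then show ?thesis by simp
qed

lemma computable_pred_imp [computable_intros]:
  assumes "computable_pred P" "computable_pred Q" shows "computable_pred (\<lambda>x. P x \<longrightarrow> Q x)"
  unfolding imp_conv_disj by (intro computable_intros assms)

lemma computable_pred_less [computable_intros]:
  assumes "computable f" "computable g" shows "computable_pred (\<lambda>x. f x < g x)"
  using computable_pred_le[OF computable_Suc[OF assms(1)] assms(2)] by (simp add: Suc_le_eq)

lemma computable_pred_eq [computable_intros]: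
  assumes "computable f" "computable g" shows "computable_pred (\<lambda>x. f x = g x)"
  using computable_pred_conj[OF computable_pred_le[OF assms] computable_pred_le[OF assms(2,1)]]
  by (simp add: eq_iff)

lemma computable_pred_iff [computable_intros]:
  assumes "computable_pred P" "computable_pred Q" shows "computable_pred (\<lambda>x. P x \<longleftrightarrow> Q x)"
  unfolding iff_conv_conj_imp by (intro computable_intros assms)

text \<open>A computable sum counts the counterexamples below the bound; the quantifier says that
  the count is zero.\<close>

lemma computable_pred_ball [computable_intros]:
  assumes P: "computable_pred (\<lambda>z. P (pfst z) (psnd z))" and n: "computable n"
  shows "computable_pred (\<lambda>x. \<forall>i<n x. P x i)"
proof -
  have "computable_pred (\<lambda>x. (\<Sum>i<n x. of_bool (\<not> P x i)) = (0::nat))"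
    by (intro computable_intros computable_sum computable_pred_comp2[OF P] n)
  moreover have "(\<Sum>i<n x. of_bool (\<not> P x i)) = (0::nat) \<longleftrightarrow> (\<forall>i<n x. P x i)" for x
    by (simp only: sum_eq_0_iff finite_lessThan) auto
  ultimately show ?thesis by simp
qed

lemma computable_pred_bex [computable_intros]:
  assumes P: "computable_pred (\<lambda>z. P (pfst z) (psnd z))" and n: "computable n"
  shows "computable_pred (\<lambda>x. \<exists>i<n x. P x i)"
  using computable_pred_not[OF computable_pred_ball[OF computable_pred_not[OF P] n]] by simp

lemma computable_pred_odd [computable_intros]:
  assumes "computable f" shows "computable_pred (\<lambda>x. odd (f x))"
proof -
  have "rec_nat 0 (\<lambda>_ r. 1 - r) n = (of_bool (odd n) :: nat)" for n by (induction n) auto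
  moreover have "computable (\<lambda>x. rec_nat 0 (\<lambda>_ r. 1 - r) (f x))" by (intro computable_intros assms)
  ultimately show ?thesis unfolding computable_pred_def by simp
qed

lemma computable_div2 [computable_intros]:
  assumes "computable f" shows "computable (\<lambda>x. f x div 2)"
proof -
  \<comment> \<open>Half of \<open>n\<close> is the number of odd numbers below
    \<open>n\<close>.\<close>
  have "(\<Sum>i<n. of_bool (odd i)) = n div 2" for n :: nat by (induction n) auto
  moreover have "computable (\<lambda>x. \<Sum>i<f x. of_bool (odd i))"
    by (intro computable_intros computable_sum assms)
  ultimately show ?thesis by simp
qed

text \<open>Membership in a canonically indexed set is a bit test: halve \<open>f x\<close> times
  and look at the parity.\<close>

lemma computable_pred_set_decode [computable_intros]:
  assumes "computable f" "computable g" shows "computable_pred (\<lambda>x. f x \<in> set_decode (g x))"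
proof -
  have "rec_nat m (\<lambda>_ r. r div 2) n = m div 2 ^ n" for m n :: nat
    by (induction n) (auto simp: div_mult2_eq[symmetric] mult.commute)
  moreover have "computable_pred (\<lambda>x. odd (rec_nat (g x) (\<lambda>_ r. r div 2) (f x)))"
    by (intro computable_intros assms)
  ultimately show ?thesis by (simp add: set_decode_def)
qed

lemma set_encode_eq_sum:
  assumes "A \<subseteq> {..<n}"
  shows "set_encode A = (\<Sum>q<n. if q \<in> A then 2 ^ q else 0)"
proof -
  have "{..<n} \<inter> A = A" using assms by auto
  then show ?thesis unfolding set_encode_def by (simp add: sum.If_cases)
qed

lemma computable_set_encode [computable_intros]:
  assumes P: "computable_pred (\<lambda>z. P (pfst z) (psnd z))" and n: "computable n"
  shows "computable (\<lambda>x. set_encode {q. q < n x \<and> P x q})"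
proof -
  have "set_encode {q. q < n x \<and> P x q} = (\<Sum>q<n x. if P x q then 2 ^ q else 0)" for x
    by (subst set_encode_eq_sum[of _ "n x"]) (auto intro!: sum.cong)
  moreover have "computable (\<lambda>x. \<Sum>q<n x. if P x q then 2 ^ q else 0)"
    by (intro computable_intros computable_sum computable_pred_comp2[OF P] n)
  ultimately show ?thesis by simp
qed

text \<open>Turns quantifiers over \<open>set_decode m\<close> into bounded, hence computable,
  ones.\<close>

lemma mem_set_decode_less: "q \<in> set_decode m \<Longrightarrow> q < m"
proof (rule ccontr)
  assume "q \<in> set_decode m" "\<not> q < m"
  moreover have "q < 2 ^ q" by simp
  ultimately show False by (auto simp: set_decode_def)
qed

text \<open>The operator \<open>mu\<close> looks for a zero, so the characteristic function is
  flipped. That function is total, so the definedness clause of \<open>is_mu\<close> only says that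
  earlier candidates fail.\<close>

lemma partrec_Least:
  assumes P: "computable_pred (\<lambda>z. P (pfst z) (psnd z))"
  shows "partrec (\<lambda>a. if \<exists>n. P a n then Some (LEAST n. P a n) else None)"
proof -
  let ?f = "\<lambda>z. 1 - of_bool (P (pfst z) (psnd z)) :: nat"
  have f: "computable ?f" by (intro computable_intros P)
  have mu: "is_mu (\<lambda>z. Some (?f z)) a n \<longleftrightarrow> P a n \<and> (\<forall>m<n. \<not> P a m)" for a n
    by (auto simp: is_mu_def)
  have ex: "(\<exists>n. P a n \<and> (\<forall>m<n. \<not> P a m)) \<longleftrightarrow> (\<exists>n. P a n)" for a
    by (metis exists_least_iff)
  have the: "(THE n. P a n \<and> (\<forall>m<n. \<not> P a m)) = (LEAST n. P a n)" for a
    unfolding Least_def by (rule arg_cong[where f = The]) (auto simp: fun_eq_iff not_less[symmetric])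
  from partrec.mu[OF f[unfolded computable_def]] show ?thesis
    unfolding mu ex the .
qed

section \<open>List codes and course-of-values recursion\<close>

text \<open>A nonempty list has the code \<open>Suc (prod_encode (head, tail))\<close>: subtracting
  1 exposes the pair, and \<open>psnd\<close> takes the tail. At the empty list the truncated
  subtraction and \<open>prod_decode_0\<close> keep the code at 0.\<close>

definition lnth :: "nat \<Rightarrow> nat \<Rightarrow> nat" where
  "lnth c i = pfst (rec_nat c (\<lambda>_ r. psnd (r - 1)) i - 1)"

lemma computable_lnth [computable_intros]:
  "computable f \<Longrightarrow> computable g \<Longrightarrow> computable (\<lambda>x. lnth (f x) (g x))"
  unfolding lnth_def by (intro computable_intros)

lemma prod_encode_0_0: "prod_encode (0, 0) = 0"
  by (simp add: prod_encode_def)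

lemma prod_decode_0: "prod_decode 0 = (0, 0)"
  using prod_encode_inverse[of "(0, 0)"] by (simp add: prod_encode_0_0)

lemma lnth_list_encode:
  assumes "i < length xs" shows "lnth (list_encode xs) i = xs ! i"
proof -
  have tl: "psnd (list_encode ys - 1) = list_encode (tl ys)" for ys
    by (cases ys) (simp_all add: prod_decode_0)
  have "rec_nat (list_encode xs) (\<lambda>_ r. psnd (r - 1)) j = list_encode (drop j xs)" for j
    by (induction j) (simp_all add: tl[simplified] drop_Suc tl_drop)
  moreover have "drop i xs = xs ! i # drop (Suc i) xs"
    using assms by (simp add: Cons_nth_drop_Suc)
  ultimately show ?thesis by (simp add: lnth_def)
qed

text \<open>The latest value comes first, so extending the history from \<open>x\<close> to
  \<open>Suc x\<close> is a single cons, as primitive recursion requires.\<close>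

definition values_below :: "(nat \<Rightarrow> nat) \<Rightarrow> nat \<Rightarrow> nat" where
  "values_below F x = list_encode (map F (rev [0..<x]))"

lemma lnth_values_below:
  assumes "y < x" shows "lnth (values_below F x) (x - Suc y) = F y"
  using assms by (simp add: values_below_def lnth_list_encode rev_nth)

text \<open>Primitive recursion builds the history itself: \<open>?H\<close> prepends to the list so
  far the value that \<open>step\<close> computes from that list.\<close>

lemma computable_course_of_values:
  assumes step: "computable (\<lambda>z. step (pfst z) (pfst (psnd z)) (psnd (psnd z)))"
    and eq: "\<And>a x. F a x = step a x (values_below (F a) x)"
    and f: "computable f" and g: "computable g"
  shows "computable (\<lambda>x. F (f x) (g x))"
proof -
  let ?H = "\<lambda>a. rec_nat 0 (\<lambda>i r. Suc (prod_encode (step a i r, r)))"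
  have H: "?H a x = values_below (F a) x" for a x
    by (induction x) (simp_all add: eq[symmetric, unfolded values_below_def] values_below_def)
  have "computable (\<lambda>x. step (f x) (g x) (?H (f x) (g x)))"
    by (intro computable_intros computable_comp3[OF step] f g computable_comp[OF f])
  then show ?thesis by (simp only: H eq[symmetric])
qed

text \<open>A Cantor code is at least the sum of its components, so a nonzero tag makes the descent
  to the payload strict. This justifies recursion under the tags 2 and 3.\<close>

lemma psnd_less: "pfst x > 0 \<Longrightarrow> psnd x < x"
proof -
  assume *: "pfst x > 0"
  have "k \<le> triangle k" for k by (induction k) auto
  then have "pfst x + psnd x \<le> triangle (pfst x + psnd x)" .
  also have "\<dots> \<le> prod_encode (pfst x, psnd x)" by (simp add: prod_encode_def del: prod.collapse)
  finally show ?thesis using * by simp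
qed

lemma pfst_le: "pfst x \<le> x" and psnd_le: "psnd x \<le> x"
  using le_prod_encode_1[of "pfst x" "psnd x"] le_prod_encode_2[of "psnd x" "pfst x"] by simp_all

text \<open>
  Structural recursion on \<^const>\<open>rexpr_code\<close> with a parameter: the tags \<open>2\<close> and \<open>3\<close> are those of
  \<^const>\<open>Cross\<close> and \<^const>\<open>Juxt\<close>; every other number, code or not, counts as a leaf.
\<close>

function expr_fold ::
  "(nat \<Rightarrow> nat \<Rightarrow> nat) \<Rightarrow> (nat \<Rightarrow> nat \<Rightarrow> nat) \<Rightarrow> (nat \<Rightarrow> nat \<Rightarrow> nat \<Rightarrow> nat) \<Rightarrow> nat \<Rightarrow> nat \<Rightarrow> nat" where
  "expr_fold l c j a x =
     (if pfst x = 2 then c a (expr_fold l c j a (psnd x))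
      else if pfst x = 3 then
        j a (expr_fold l c j a (pfst (psnd x))) (expr_fold l c j a (psnd (psnd x)))
      else l a x)"
  by pat_completeness auto
termination
  by (relation "measure (\<lambda>(l, c, j, a, x). x)")
    (auto intro: psnd_less le_less_trans[OF pfst_le psnd_less] le_less_trans[OF psnd_le psnd_less])

declare expr_fold.simps [simp del]

lemma computable_expr_fold:
  assumes l: "computable (\<lambda>z. l (pfst z) (psnd z))"
    and c: "computable (\<lambda>z. c (pfst z) (psnd z))"
    and j: "computable (\<lambda>z. j (pfst z) (pfst (psnd z)) (psnd (psnd z)))"
    and f: "computable f" and g: "computable g"
  shows "computable (\<lambda>x. expr_fold l c j (f x) (g x))"
proof (rule computable_course_of_values[OF _ _ f g])
  let ?rec = "\<lambda>H x y. lnth H (x - Suc y)"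
  let ?step = "\<lambda>a x H. if pfst x = 2 then c a (?rec H x (psnd x))
    else if pfst x = 3 then j a (?rec H x (pfst (psnd x))) (?rec H x (psnd (psnd x)))
    else l a x"
  show "computable (\<lambda>z. ?step (pfst z) (pfst (psnd z)) (psnd (psnd z)))"
    by (intro computable_intros computable_comp3[OF j] computable_comp2[OF c] computable_comp2[OF l])
  show "expr_fold l c j a x = ?step a x (values_below (expr_fold l c j a) x)" for a x
  proof -
    \<comment> \<open>In the recursive branches all lookups stay inside the history, where
      \<open>lnth\<close> returns the intended values.\<close>
    have "psnd x < x" "pfst (psnd x) < x" "psnd (psnd x) < x" if "pfst x = 2 \<or> pfst x = 3"
      using that psnd_less[of x] pfst_le[of "psnd x"] psnd_le[of "psnd x"] by auto
    then show ?thesis by (subst expr_fold.simps) (simp add: lnth_values_below)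
  qed
qed

lemma expr_fold_Cross: "expr_fold l c j a (prod_encode (2, y)) = c a (expr_fold l c j a y)"
  by (subst expr_fold.simps) simp

lemma expr_fold_Juxt:
  "expr_fold l c j a (prod_encode (3, prod_encode (x, y))) =
     j a (expr_fold l c j a x) (expr_fold l c j a y)"
  by (subst expr_fold.simps) simp

lemma expr_fold_leaf:
  "pfst x \<noteq> 2 \<Longrightarrow> pfst x \<noteq> 3 \<Longrightarrow> expr_fold l c j a x = l a x"
  by (subst expr_fold.simps) simp

lemmas expr_fold_code = expr_fold_Cross expr_fold_Juxt expr_fold_leaf

function list_fold :: "(nat \<Rightarrow> nat) \<Rightarrow> (nat \<Rightarrow> nat \<Rightarrow> nat \<Rightarrow> nat) \<Rightarrow> nat \<Rightarrow> nat \<Rightarrow> nat" where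
  "list_fold n c a 0 = n a"
| "list_fold n c a (Suc x) = c a (pfst x) (list_fold n c a (psnd x))"
  by pat_completeness auto
termination
  by (relation "measure (\<lambda>(n, c, a, x). x)") (auto simp: less_Suc_eq_le psnd_le)

lemma computable_list_fold:
  assumes n: "computable n"
    and c: "computable (\<lambda>z. c (pfst z) (pfst (psnd z)) (psnd (psnd z)))"
    and f: "computable f" and g: "computable g"
  shows "computable (\<lambda>x. list_fold n c (f x) (g x))"
proof (rule computable_course_of_values[OF _ _ f g])
  let ?step = "\<lambda>a x H. if x = 0 then n a
    else c a (pfst (x - 1)) (lnth H (x - Suc (psnd (x - 1))))"
  show "computable (\<lambda>z. ?step (pfst z) (pfst (psnd z)) (psnd (psnd z)))"
    by (intro computable_intros computable_comp3[OF c] computable_comp[OF n])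
  show "list_fold n c a x = ?step a x (values_below (list_fold n c a) x)" for a x
  proof (cases x)
    case (Suc y)
    have "psnd y < x" using Suc psnd_le[of y] by simp
    from lnth_values_below[OF this] Suc show ?thesis by simp
  qed simp
qed

section \<open>Periodicity of the iterates\<close>

text \<open>Among the first \<open>card X + 1\<close> states two coincide, at times
  \<open>i < j\<close>, and determinism copies the coincidence forward. With \<open>T = i\<close>
  and \<open>P = j - i\<close> the sum is \<open>j\<close>, so the bound holds for transient and
  period together.\<close>

lemma recurrence_of_finite:
  fixes s :: "nat \<Rightarrow> 'a"
  assumes det: "\<And>i j. s i = s j \<Longrightarrow> s (Suc i) = s (Suc j)"
    and fin: "finite X" and ran: "\<And>k. s k \<in> X"
  shows "\<exists>T P. P > 0 \<and> T + P \<le> card X \<and> (\<forall>k\<ge>T. s (k + P) = s k)"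
proof -
  have "\<not> inj_on s {..card X}"
  proof
    assume "inj_on s {..card X}"
    then have "card {..card X} \<le> card X"
      using ran by (intro card_inj_on_le[OF _ _ fin]) auto
    then show False by simp
  qed
  then obtain i j where ij: "i < j" "j \<le> card X" "s i = s j"
    unfolding inj_on_def by (metis atMost_iff linorder_neqE_nat)
  have "s (i + d) = s (j + d)" for d
    by (induction d) (auto intro: ij det)
  then have "s (k + (j - i)) = s k" if "k \<ge> i" for k
  proof -
    have "i + (k - i) = k" "j + (k - i) = k + (j - i)" using that ij(1) by simp_all
    with \<open>s (i + (k - i)) = s (j + (k - i))\<close> show ?thesis by simp
  qed
  with ij show ?thesis by (intro exI[of _ i] exI[of _ "j - i"]) auto
qed

lemma recurrence_iterate:
  fixes x :: "nat \<Rightarrow> 'a"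
  assumes "\<And>k. k \<ge> T \<Longrightarrow> x (k + P) = x k" "k \<ge> T"
  shows "x (k + m * P) = x k"
proof (induction m)
  case (Suc m)
  have "x (k + Suc m * P) = x ((k + m * P) + P)" by (simp add: algebra_simps)
  also have "\<dots> = x (k + m * P)" using assms by auto
  finally show ?case using Suc by simp
qed simp

text \<open>Every eventual period already holds from \<open>T\<close> on: move \<open>k\<close> up
  by \<open>U\<close> multiples of \<open>P\<close>, into the range where \<open>Q\<close> is known
  to work, shift by \<open>Q\<close>, and move back down.\<close>

lemma eventual_period_shift:
  assumes P: "P > 0" "\<And>k. k \<ge> T \<Longrightarrow> x (k + P) = x k" and Q: "is_eventual_period x Q" and k: "k \<ge> T"
  shows "x (k + Q) = x k"
proof -
  from Q obtain U where U: "\<And>k. k \<ge> U \<Longrightarrow> x (k + Q) = x k" by (auto simp: is_eventual_period_def)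
  have "U \<le> U * P" using P by simp
  then have "k + U * P \<ge> U" by (rule trans_le_add2)
  from U[OF this] have "x ((k + Q) + U * P) = x (k + U * P)" by (simp add: algebra_simps)
  then show ?thesis using recurrence_iterate[of T x P, OF P(2)] k by simp
qed

text \<open>\<open>transient\<close> is defined relative to the least period, which may be smaller
  than \<open>P\<close>; by \<open>eventual_period_shift\<close> that period also holds from
  \<open>T\<close> on.\<close>

lemma transient_eventual_period_le:
  assumes P: "P > 0" "\<And>k. k \<ge> T \<Longrightarrow> x (k + P) = x k"
  shows "eventually_periodic x" "transient x + eventual_period x \<le> T + P"
proof -
  have *: "is_eventual_period x P" using P unfolding is_eventual_period_def by blast
  then show "eventually_periodic x" unfolding eventually_periodic_def by blast
  have "eventual_period x \<le> P" unfolding eventual_period_def using * by (rule Least_le)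
  moreover have "is_eventual_period x (eventual_period x)"
    unfolding eventual_period_def using * by (rule LeastI)
  then have "transient x \<le> T"
    unfolding transient_def by (intro Least_le allI impI eventual_period_shift[of P T x, OF P])
  ultimately show "transient x + eventual_period x \<le> T + P" by simp
qed

text \<open>Beyond \<open>T\<close> both sides of \<open>x (k + Q) = x k\<close> have period
  \<open>P\<close> in \<open>k\<close>, so it is enough to test one representative of each residue
  modulo \<open>P\<close>. This makes the test for a period a bounded one.\<close>

lemma is_eventual_period_iff_window:
  assumes P: "P > 0" "\<And>k. k \<ge> T \<Longrightarrow> x (k + P) = x k" and N: "T \<le> N" "P \<le> N"
  shows "is_eventual_period x Q \<longleftrightarrow> Q > 0 \<and> (\<forall>k<N. x (N + k + Q) = x (N + k))"
proof
  assume "is_eventual_period x Q"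
  with eventual_period_shift[of P T x, OF P] N(1) show "Q > 0 \<and> (\<forall>k<N. x (N + k + Q) = x (N + k))"
    by (auto simp: is_eventual_period_def)
next
  assume Q: "Q > 0 \<and> (\<forall>k<N. x (N + k + Q) = x (N + k))"
  have "x (k + Q) = x k" if "k \<ge> N" for k
  proof -
    define r where "r = (k - N) mod P"
    have r: "r < N" using mod_less_divisor[OF P(1), of "k - N"] N(2) by (simp add: r_def)
    have k: "k = N + r + (k - N) div P * P" using that by (simp add: r_def)
    then have "k + Q = (N + r + Q) + (k - N) div P * P" by linarith
    then have "x (k + Q) = x ((N + r + Q) + (k - N) div P * P)" by (rule arg_cong)
    also have "\<dots> = x (N + r + Q)" using N by (intro recurrence_iterate[of T] P) auto
    also have "\<dots> = x (N + r)" using Q r by simp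
    also have "\<dots> = x (N + r + (k - N) div P * P)"
      using N by (intro recurrence_iterate[of T, symmetric] P) auto
    also have "\<dots> = x k" by (simp only: k[symmetric])
    finally show ?thesis .
  qed
  with Q show "is_eventual_period x Q" by (auto simp: is_eventual_period_def)
qed

section \<open>Iterates on a finite set closed under asking\<close>

context
  fixes D :: "'s domain_pres"
  assumes pres: "presentation D"
begin

lemma nump_sysp: "nump D p \<in> sysp D"
  using pres by (auto simp: presentation_def computable_numbering_def)

lemma fill_cong: "(\<And>q. q \<in> asks D p \<Longrightarrow> \<alpha> q = \<beta> q) \<Longrightarrow> fill D (nump D p) \<alpha> = fill D (nump D p) \<beta>"
  using pres nump_sysp[of p] by (auto simp: presentation_def asks_def)

text \<open>The state at stage \<open>k\<close> is the set of marked members of \<open>X\<close>;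
  closedness and \<open>fill_cong\<close> make it determine the next state. \<open>X\<close> is
  arbitrary because the search for the period may find a closed set other than
  \<open>asks_closure\<close>.\<close>

lemma iterate_recurrence:
  assumes fin: "finite X" and closed: "\<And>q. q \<in> X \<Longrightarrow> asks D q \<subseteq> X"
  shows "\<exists>T P. P > 0 \<and> T + P \<le> 2 ^ card X \<and>
    (\<forall>k\<ge>T. \<forall>q\<in>X. iterate D (k + P) q = iterate D k q)"
proof -
  define s where "s k = {q \<in> X. iterate D k q}" for k
  have det: "s (Suc i) = s (Suc j)" if "s i = s j" for i j
  proof -
    have "iterate D (Suc i) q = iterate D (Suc j) q" if "q \<in> X" for q
    proof -
      have "fill D (nump D q) (iterate D i) = fill D (nump D q) (iterate D j)"
        using \<open>s i = s j\<close> closed[OF that] by (intro fill_cong) (auto simp: s_def)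
      then show ?thesis by simp
    qed
    then show ?thesis unfolding s_def by blast
  qed
  have ran: "finite (Pow X)" "\<And>k. s k \<in> Pow X" using fin by (auto simp: s_def)
  obtain T P where TP: "P > 0" "T + P \<le> card (Pow X)" "\<forall>k\<ge>T. s (k + P) = s k"
    using recurrence_of_finite[of s "Pow X"] det ran by blast
  have "iterate D (k + P) q = iterate D k q" if "k \<ge> T" "q \<in> X" for k q
    using TP(3) that unfolding s_def by blast
  with TP show ?thesis using fin by (intro exI[of _ T] exI[of _ P]) (auto simp: card_Pow)
qed

lemma iterate_eventually_periodic:
  assumes "finite (asks_closure D p)"
  shows "eventually_periodic (\<lambda>k. iterate D k p)"
    "transient (\<lambda>k. iterate D k p) + eventual_period (\<lambda>k. iterate D k p) \<le> 2 ^ card (asks_closure D p)"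
proof -
  have closed: "asks D q \<subseteq> asks_closure D p" if "q \<in> asks_closure D p" for q
    using asks_closure.step[OF that] by blast
  obtain T P where TP: "P > 0" "T + P \<le> 2 ^ card (asks_closure D p)"
    "\<forall>k\<ge>T. \<forall>q\<in>asks_closure D p. iterate D (k + P) q = iterate D k q"
    using iterate_recurrence[OF assms closed] by blast
  have "iterate D (k + P) p = iterate D k p" if "k \<ge> T" for k
    using TP(3) that asks_closure.base[of p D] by blast
  from transient_eventual_period_le[of P T "\<lambda>k. iterate D k p", OF TP(1) this] TP(2)
  show "eventually_periodic (\<lambda>k. iterate D k p)"
    "transient (\<lambda>k. iterate D k p) + eventual_period (\<lambda>k. iterate D k p) \<le> 2 ^ card (asks_closure D p)"
    by linarith+
qed

end

text \<open>The subsets of \<open>A\<close> have distinct codes, none above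
  \<open>set_encode A\<close>. The size of the window is thus read off the code, with no need to
  compute a cardinality.\<close>

lemma power_card_le_Suc_set_encode:
  assumes "finite A" shows "2 ^ card A \<le> Suc (set_encode A)"
proof -
  have "card (Pow A) \<le> card {..set_encode A}"
  proof (rule card_inj_on_le[of set_encode])
    show "inj_on set_encode (Pow A)"
      using inj_on_set_encode by (rule inj_on_subset) (use assms in \<open>auto intro: finite_subset\<close>)
    show "set_encode ` Pow A \<subseteq> {..set_encode A}"
      using assms by (auto simp: set_encode_def intro!: sum_mono2)
  qed simp
  then show ?thesis using assms by (simp add: card_Pow)
qed

lemma eventual_period_partrec:
  assumes D: "decidable_domain D"
  shows "\<exists>f. partrec f \<and> (\<forall>p. finite (asks_closure D p) \<longrightarrow>
    f (goedel D (nump D p)) = Some (eventual_period (\<lambda>k. iterate D k p)))"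
proof -
  have pres: "presentation D" using D by (simp add: decidable_domain_def)
  define M where "M = goedel D ` {s \<in> sys D. manifests D s}"
  have M: "computable_pred (\<lambda>x. x \<in> M)"
    using D by (simp add: decidable_domain_def M_def decidable_set_iff)
  have "\<exists>g. computable g \<and> (\<forall>s\<in>sysp D. g (goedel D s) = set_encode (gates D s))"
    using pres unfolding presentation_def by (elim conjE)
  then obtain g where g: "computable g"
      "\<And>s. s \<in> sysp D \<Longrightarrow> g (goedel D s) = set_encode (gates D s)"
    by blast
  have "\<exists>h. computable h \<and> (\<forall>s\<in>sysp D. \<forall>A. finite A \<longrightarrow>
      h (prod_encode (goedel D s, set_encode A)) = goedel D (fill D s (\<lambda>q. q \<in> A)))"
    using pres unfolding presentation_def by (elim conjE)
  then obtain h where h: "computable h" "\<And>s A. s \<in> sysp D \<Longrightarrow> finite A \<Longrightarrow>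
      h (prod_encode (goedel D s, set_encode A)) = goedel D (fill D s (\<lambda>q. q \<in> A))"
    by blast
  have inj: "inj_on (goedel D) (sysp D)" and sub: "sys D \<subseteq> sysp D"
    and fill_sys: "\<And>s \<alpha>. s \<in> sysp D \<Longrightarrow> fill D s \<alpha> \<in> sys D"
    and fin_gates: "\<And>s. s \<in> sysp D \<Longrightarrow> finite (gates D s)"
    using pres unfolding presentation_def by auto
  note nump = nump_sysp[OF pres]
  have M_iff: "goedel D s \<in> M \<longleftrightarrow> manifests D s" if "s \<in> sys D" for s
  proof -
    have "{s \<in> sys D. manifests D s} \<subseteq> sysp D" "s \<in> sysp D" using sub that by auto
    from inj_on_image_mem_iff[OF inj this(2,1)] that show ?thesis by (simp add: M_def)
  qed
  define c where "c p = goedel D (nump D p)" for p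
  have c: "computable c"
    using pres by (simp add: presentation_def computable_numbering_def c_def[abs_def])
  define G where "G q = g (c q)" for q
  have G: "computable G" unfolding G_def[abs_def] by (intro computable_comp[OF g(1)] c)
  have G_asks: "set_decode (G q) = asks D q" for q
    using g(2)[OF nump] fin_gates[OF nump] by (simp add: G_def c_def asks_def)
  define fails where "fails q A \<longleftrightarrow> h (prod_encode (c q, A)) \<notin> M" for q A
  have fails_iff: "fails q A \<longleftrightarrow> \<not> manifests D (fill D (nump D q) (\<lambda>r. r \<in> set_decode A))" for q A
  proof -
    have "h (prod_encode (c q, A)) = goedel D (fill D (nump D q) (\<lambda>r. r \<in> set_decode A))"
      using h(2)[OF nump, of "set_decode A" q] by (simp add: c_def)
    moreover have "fill D (nump D q) (\<lambda>r. r \<in> set_decode A) \<in> sys D" by (rule fill_sys[OF nump])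
    ultimately show ?thesis using M_iff by (simp add: fails_def)
  qed
  define closed where "closed m \<longleftrightarrow> (\<forall>q<m. q \<in> set_decode m \<longrightarrow>
      (\<forall>r<G q. r \<in> set_decode (G q) \<longrightarrow> r \<in> set_decode m))" for m
  have closed_iff: "closed m \<longleftrightarrow> (\<forall>q\<in>set_decode m. asks D q \<subseteq> set_decode m)" for m
    unfolding closed_def G_asks[symmetric] by (meson mem_set_decode_less subset_iff)
  \<comment> \<open>All members of the closed set are evolved at once, as one canonical index; the
    start 0 codes the empty set, which is the all-void iterate.\<close>
  define state where "state m k =
    rec_nat 0 (\<lambda>_ A. set_encode {q. q < m \<and> q \<in> set_decode m \<and> fails q A}) k" for m k :: nat
  have state: "set_decode (state m k) = {q \<in> set_decode m. iterate D k q}" if "closed m" for m k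
  proof (induction k)
    case 0
    then show ?case by (simp add: state_def)
  next
    case (Suc k)
    have "fails q (state m k) \<longleftrightarrow> iterate D (Suc k) q" if q: "q \<in> set_decode m" for q
    proof -
      have "fill D (nump D q) (\<lambda>r. r \<in> set_decode (state m k)) = fill D (nump D q) (iterate D k)"
        using q \<open>closed m\<close> by (intro fill_cong[OF pres]) (auto simp: Suc closed_iff)
      then show ?thesis by (simp add: fails_iff)
    qed
    moreover have "set_decode (state m (Suc k)) =
        {q. q < m \<and> q \<in> set_decode m \<and> fails q (state m k)}"
      unfolding state_def by simp
    ultimately show ?case using mem_set_decode_less by blast
  qed
  \<comment> \<open>\<open>w\<close> pairs a candidate index with the canonical index of a candidate
    closed set.\<close>
  define R where "R code w \<longleftrightarrow>
    c (pfst w) = code \<and> pfst w \<in> set_decode (psnd w) \<and> closed (psnd w)" for code w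
  define S where "S w P \<longleftrightarrow> P > 0 \<and> (\<forall>k<Suc (psnd w).
      (pfst w \<in> set_decode (state (psnd w) (Suc (psnd w) + k + P))) =
      (pfst w \<in> set_decode (state (psnd w) (Suc (psnd w) + k))))" for w P
  have "computable_pred (\<lambda>z. R (pfst z) (psnd z))"
    unfolding R_def closed_def by (intro computable_intros computable_comp[OF c] computable_comp[OF G])
  note R = partrec_Least[OF this]
  have "computable_pred (\<lambda>z. S (pfst z) (psnd z))"
    unfolding S_def state_def fails_def
    by (intro computable_intros computable_pred_comp[OF M] computable_comp[OF c] computable_comp[OF h(1)])
  note S = partrec_Least[OF this]
  let ?f = "\<lambda>code. Option.bind (if \<exists>w. R code w then Some (LEAST w. R code w) else None)
    (\<lambda>w. if \<exists>P. S w P then Some (LEAST P. S w P) else None)"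
  have "?f (c p) = Some (eventual_period (\<lambda>k. iterate D k p))" if fin: "finite (asks_closure D p)" for p
  proof -
    have "R (c p) (prod_encode (p, set_encode (asks_closure D p)))"
      using fin asks_closure.base[of p D] asks_closure.step[of _ D p]
      by (auto simp: R_def closed_iff)
    then have ex: "\<exists>w. R (c p) w" by blast
    define w where "w = (LEAST w. R (c p) w)"
    have "R (c p) w" unfolding w_def using ex by (rule LeastI_ex)
    then have w: "c (pfst w) = c p" "pfst w \<in> set_decode (psnd w)" "closed (psnd w)"
      by (auto simp: R_def)
    have "nump D (pfst w) = nump D p"
      using w(1) inj nump unfolding c_def inj_on_def by blast
    \<comment> \<open>The index found may differ from \<open>p\<close>. Stage 0 is void at every
      index, and a later stage sees the index only through \<open>nump\<close>.\<close>
    then have iter: "iterate D k (pfst w) = iterate D k p" for k by (cases k) simp_all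
    obtain T P where TP: "P > 0" "T + P \<le> 2 ^ card (set_decode (psnd w))"
      "\<forall>k\<ge>T. \<forall>q\<in>set_decode (psnd w). iterate D (k + P) q = iterate D k q"
      using iterate_recurrence[OF pres finite_set_decode] w(3) unfolding closed_iff by blast
    have "T + P \<le> Suc (psnd w)"
      using TP(2) power_card_le_Suc_set_encode[OF finite_set_decode, of "psnd w"] by simp
    moreover have "iterate D (k + P) p = iterate D k p" if "k \<ge> T" for k
      using TP(3) w(2) that iter by metis
    ultimately have "is_eventual_period (\<lambda>k. iterate D k p) Q \<longleftrightarrow> S w Q" for Q
      using is_eventual_period_iff_window[of P T "\<lambda>k. iterate D k p" "Suc (psnd w)" Q] TP(1) w(2)
      unfolding S_def state[OF w(3)] by (simp add: iter del: iterate.simps)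
    then have S_eq: "S w = is_eventual_period (\<lambda>k. iterate D k p)" by (simp add: fun_eq_iff)
    have "\<exists>Q. S w Q"
      using iterate_eventually_periodic(1)[OF pres fin] by (simp add: eventually_periodic_def S_eq)
    with ex show ?thesis by (simp add: w_def[symmetric] S_eq eventual_period_def)
  qed
  with partrec.comp[OF S R] show ?thesis unfolding c_def by blast
qed

section \<open>Decidability of the re-entry domain\<close>

text \<open>The leaf \<open>x = 0\<close> is \<open>Void\<close>, since
  \<open>prod_encode (0, 0) = 0\<close>; multiplication serves as conjunction.\<close>

definition expr_ok :: "nat \<Rightarrow> nat \<Rightarrow> nat" where
  "expr_ok = expr_fold (\<lambda>n x. of_bool (pfst x = 1 \<and> psnd x < n \<or> pfst x = 4 \<or> x = 0))
     (\<lambda>n r. r) (\<lambda>n r s. r * s)"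

definition expr_gate :: "nat \<Rightarrow> nat \<Rightarrow> nat" where
  "expr_gate = expr_fold (\<lambda>q x. of_bool (x = prod_encode (4, q)))
     (\<lambda>q r. r) (\<lambda>q r s. of_bool (r + s > 0))"

text \<open>\<open>prod_encode (2, 0)\<close> is the code of \<open>Cross Void\<close>, that is, of
  mark.\<close>

definition expr_subst :: "nat \<Rightarrow> nat \<Rightarrow> nat" where
  "expr_subst = expr_fold
     (\<lambda>A x. if pfst x = 4 then if psnd x \<in> set_decode A then prod_encode (2, 0) else 0 else x)
     (\<lambda>A r. prod_encode (2, r)) (\<lambda>A r s. prod_encode (3, prod_encode (r, s)))"

definition expr_value :: "nat \<Rightarrow> nat \<Rightarrow> nat" where
  "expr_value = expr_fold (\<lambda>\<sigma> x. if pfst x = 1 then lnth \<sigma> (psnd x) else 0)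
     (\<lambda>\<sigma> r. 1 - r) (\<lambda>\<sigma> r s. of_bool (r + s > 0))"

lemma computable_expr_ops [computable_intros]:
  assumes "computable f" "computable g"
  shows "computable (\<lambda>x. expr_ok (f x) (g x))" "computable (\<lambda>x. expr_gate (f x) (g x))"
    "computable (\<lambda>x. expr_subst (f x) (g x))" "computable (\<lambda>x. expr_value (f x) (g x))"
  unfolding expr_ok_def expr_gate_def expr_subst_def expr_value_def
  by (intro computable_expr_fold computable_intros assms)+

lemma inj_rexpr_code: "inj rexpr_code"
proof (rule injI)
  show "e = f" if "rexpr_code e = rexpr_code f" for e f
    using that
  proof (induction e arbitrary: f)
    case Void then show ?case by (cases f) simp_all
  next
    case (Var i) then show ?case by (cases f) simp_all
  next
    case (Cross e) then show ?case by (cases f) simp_all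
  next
    case (Juxt e1 e2) then show ?case by (cases f) simp_all
  next
    case (Ask q) then show ?case by (cases f) simp_all
  qed
qed

text \<open>The induction is on the number and not on an expression, because numbers that code
  nothing must be rejected too.\<close>

lemma expr_ok_iff:
  "expr_ok n x = of_bool (\<exists>e. x = rexpr_code e \<and> (\<forall>i\<in>rexpr_vars e. i < n))"
proof (induction x rule: less_induct)
  case (less x)
  obtain t y where x: "x = prod_encode (t, y)" by (metis prod.collapse prod_decode_inverse)
  consider "t = 2" | "t = 3" | "t \<noteq> 2" "t \<noteq> 3" by blast
  then show ?case
  proof cases
    case 1
    then have "expr_ok n x = expr_ok n y" by (simp add: x expr_ok_def expr_fold_code)
    moreover have "y < x" using psnd_less[of x] 1 x by simp
    moreover have "(\<exists>e. x = rexpr_code e \<and> (\<forall>i\<in>rexpr_vars e. i < n)) \<longleftrightarrow>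
        (\<exists>e. y = rexpr_code e \<and> (\<forall>i\<in>rexpr_vars e. i < n))" (is "(\<exists>e. ?P e) \<longleftrightarrow> (\<exists>e. ?Q e)")
    proof
      assume "\<exists>e. ?P e"
      then obtain e where "?P e" by blast
      then show "\<exists>e. ?Q e" using 1 x by (cases e) auto
    next
      assume "\<exists>e. ?Q e"
      then obtain e where "?Q e" by blast
      then have "?P (Cross e)" using 1 x by simp
      then show "\<exists>e. ?P e" by blast
    qed
    ultimately show ?thesis using less by simp
  next
    case 2
    obtain u v where y: "y = prod_encode (u, v)" by (metis prod.collapse prod_decode_inverse)
    have "expr_ok n x = expr_ok n u * expr_ok n v" by (simp add: x y 2 expr_ok_def expr_fold_code)
    moreover have "u < x" "v < x"
      using psnd_less[of x] pfst_le[of y] psnd_le[of y] 2 x y by auto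
    moreover have "(\<exists>e. x = rexpr_code e \<and> (\<forall>i\<in>rexpr_vars e. i < n)) \<longleftrightarrow>
        (\<exists>e. u = rexpr_code e \<and> (\<forall>i\<in>rexpr_vars e. i < n)) \<and>
        (\<exists>e. v = rexpr_code e \<and> (\<forall>i\<in>rexpr_vars e. i < n))"
      (is "(\<exists>e. ?P e) \<longleftrightarrow> (\<exists>e. ?Q e) \<and> (\<exists>e. ?R e)")
    proof
      assume "\<exists>e. ?P e"
      then obtain e where "?P e" by blast
      then show "(\<exists>e. ?Q e) \<and> (\<exists>e. ?R e)" using 2 x y by (cases e) auto
    next
      assume "(\<exists>e. ?Q e) \<and> (\<exists>e. ?R e)"
      then obtain e f where "?Q e" "?R f" by blast
      then have "?P (Juxt e f)" using 2 x y by auto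
      then show "\<exists>e. ?P e" by blast
    qed
    ultimately show ?thesis using less by simp
  next
    case 3
    have "x = 0 \<longleftrightarrow> t = 0 \<and> y = 0" using prod_encode_eq[of "(t, y)" "(0, 0)"]
      by (simp add: x prod_encode_0_0)
    then have "expr_ok n x = of_bool (t = 1 \<and> y < n \<or> t = 4 \<or> t = 0 \<and> y = 0)"
      using 3 by (simp add: x expr_ok_def expr_fold_code)
    moreover have "(\<exists>e. x = rexpr_code e \<and> (\<forall>i\<in>rexpr_vars e. i < n)) \<longleftrightarrow>
        t = 1 \<and> y < n \<or> t = 4 \<or> t = 0 \<and> y = 0" (is "(\<exists>e. ?P e) \<longleftrightarrow> ?Q")
    proof
      assume "\<exists>e. ?P e"
      then obtain e where "?P e" by blast
      then show ?Q using 3 x by (cases e) auto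
    next
      assume ?Q
      then have "?P (Var y) \<or> ?P (Ask y) \<or> ?P Void" by (auto simp: x)
      then show "\<exists>e. ?P e" by blast
    qed
    ultimately show ?thesis by simp
  qed
qed

lemma expr_gate_code: "expr_gate q (rexpr_code e) = of_bool (q \<in> rexpr_gates e)"
  by (induction e) (auto simp: expr_gate_def expr_fold_code prod_encode_eq)

lemma expr_subst_code:
  "expr_subst A (rexpr_code e) = rexpr_code (rexpr_fill (\<lambda>q. q \<in> set_decode A) e)"
  by (induction e) (auto simp: expr_subst_def expr_fold_code prod_encode_0_0 prod_decode_0)

lemma expr_value_code:
  assumes "\<forall>i\<in>rexpr_vars e. i < length xs"
  shows "expr_value (list_encode (map of_bool xs)) (rexpr_code e) =
    of_bool (rexpr_eval (\<lambda>i. xs ! i) e)"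
  using assms by (induction e) (auto simp: expr_value_def expr_fold_code lnth_list_encode)

text \<open>Lets \<open>code_gates\<close> find all gates by a search bounded by the code.\<close>

lemma rexpr_gates_less: "q \<in> rexpr_gates e \<Longrightarrow> q < rexpr_code e"
proof (induction e)
  case (Cross e)
  then show ?case using psnd_less[of "rexpr_code (Cross e)"] by simp
next
  case (Juxt e f)
  let ?x = "rexpr_code (Juxt e f)"
  have "rexpr_code e < ?x" "rexpr_code f < ?x"
    using psnd_less[of ?x] pfst_le[of "psnd ?x"] psnd_le[of "psnd ?x"] by auto
  with Juxt show ?case by auto
next
  case (Ask q)
  then show ?case using psnd_less[of "rexpr_code (Ask q)"] by simp
qed auto

lemma less_list_encode: "x \<in> set xs \<Longrightarrow> x < list_encode xs"
proof (induction xs)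
  case (Cons y xs)
  have "y \<le> prod_encode (y, list_encode xs)" "list_encode xs \<le> prod_encode (y, list_encode xs)"
    by (rule le_prod_encode_1, rule le_prod_encode_2)
  with Cons show ?case by auto
qed simp

section \<open>Operations on codes of lists of expressions and bits\<close>

definition list_len :: "nat \<Rightarrow> nat" where
  "list_len = list_fold (\<lambda>_. 0) (\<lambda>_ _ r. Suc r) 0"

definition exprs_ok :: "nat \<Rightarrow> nat \<Rightarrow> nat" where
  "exprs_ok = list_fold (\<lambda>_. 1) (\<lambda>n y r. expr_ok n y * r)"

definition bits_ok :: "nat \<Rightarrow> nat" where
  "bits_ok = list_fold (\<lambda>_. 1) (\<lambda>_ y r. of_bool (y \<le> 1) * r) 0"

definition exprs_gate :: "nat \<Rightarrow> nat \<Rightarrow> nat" where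
  "exprs_gate = list_fold (\<lambda>_. 0) (\<lambda>q y r. of_bool (expr_gate q y + r > 0))"

definition exprs_subst :: "nat \<Rightarrow> nat \<Rightarrow> nat" where
  "exprs_subst = list_fold (\<lambda>_. 0) (\<lambda>A y r. Suc (prod_encode (expr_subst A y, r)))"

definition exprs_value :: "nat \<Rightarrow> nat \<Rightarrow> nat" where
  "exprs_value = list_fold (\<lambda>_. 0) (\<lambda>\<sigma> y r. Suc (prod_encode (expr_value \<sigma> y, r)))"

lemma computable_list_ops [computable_intros]:
  assumes "computable f" "computable g"
  shows "computable (\<lambda>x. exprs_ok (f x) (g x))" "computable (\<lambda>x. exprs_gate (f x) (g x))"
    "computable (\<lambda>x. exprs_subst (f x) (g x))" "computable (\<lambda>x. exprs_value (f x) (g x))"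
  unfolding exprs_ok_def exprs_gate_def exprs_subst_def exprs_value_def
  by (intro computable_list_fold computable_intros assms)+

lemma computable_list_len_bits_ok [computable_intros]:
  assumes "computable f"
  shows "computable (\<lambda>x. list_len (f x))" "computable (\<lambda>x. bits_ok (f x))"
  unfolding list_len_def bits_ok_def
  by (intro computable_list_fold computable_intros assms)+

lemma list_len_encode: "list_len (list_encode xs) = length xs"
  by (induction xs) (auto simp: list_len_def)

lemma exprs_ok_encode:
  "exprs_ok n (list_encode xs) =
     of_bool (\<forall>y\<in>set xs. \<exists>e. y = rexpr_code e \<and> (\<forall>i\<in>rexpr_vars e. i < n))"
  by (induction xs) (auto simp: exprs_ok_def expr_ok_iff)

lemma bits_ok_encode: "bits_ok (list_encode xs) = of_bool (\<forall>y\<in>set xs. y \<le> 1)"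
  by (induction xs) (auto simp: bits_ok_def)

lemma exprs_gate_encode:
  "exprs_gate q (list_encode (map rexpr_code es)) = of_bool (\<exists>e\<in>set es. q \<in> rexpr_gates e)"
  by (induction es) (auto simp: exprs_gate_def expr_gate_code)

lemma exprs_subst_encode:
  "exprs_subst A (list_encode (map rexpr_code es)) =
     list_encode (map (rexpr_code \<circ> rexpr_fill (\<lambda>q. q \<in> set_decode A)) es)"
  by (induction es) (auto simp: exprs_subst_def expr_subst_code)

lemma exprs_value_encode:
  assumes "\<forall>e\<in>set es. \<forall>i\<in>rexpr_vars e. i < length xs"
  shows "exprs_value (list_encode (map of_bool xs)) (list_encode (map rexpr_code es)) =
    list_encode (map (of_bool \<circ> rexpr_eval (\<lambda>i. xs ! i)) es)"
  using assms by (induction es) (auto simp: exprs_value_def expr_value_code)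

section \<open>Operations on codes of whole systems\<close>

definition code_ok :: "nat \<Rightarrow> bool" where
  "code_ok x \<longleftrightarrow>
     list_len (pfst (psnd x)) = list_len (pfst x) \<and>
     psnd (psnd x) < list_len (pfst x) \<and>
     exprs_ok (list_len (pfst x)) (pfst x) = 1 \<and>
     bits_ok (pfst (psnd x)) = 1"

definition code_gates :: "nat \<Rightarrow> nat" where
  "code_gates x = set_encode {q. q < x \<and> exprs_gate q (pfst x) = 1}"

definition code_fill :: "nat \<Rightarrow> nat \<Rightarrow> nat" where
  "code_fill x A = prod_encode (exprs_subst A (pfst x), psnd x)"

definition code_state :: "nat \<Rightarrow> nat \<Rightarrow> nat" where
  "code_state x t = rec_nat (pfst (psnd x)) (\<lambda>_ r. exprs_value r (pfst x)) t"

text \<open>With \<open>n\<close> Boolean variables there are \<open>2 ^ n\<close> states, so every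
  state of the run occurs before time \<open>2 ^ n\<close> and a bounded search decides
  manifestation.\<close>

definition code_manifests :: "nat \<Rightarrow> bool" where
  "code_manifests x \<longleftrightarrow> (\<exists>t<2 ^ list_len (pfst x). lnth (code_state x t) (psnd (psnd x)) = 1)"

lemma computable_code_fill [computable_intros]:
  "computable f \<Longrightarrow> computable g \<Longrightarrow> computable (\<lambda>x. code_fill (f x) (g x))"
  unfolding code_fill_def by (intro computable_intros)

lemma computable_code_ops [computable_intros]:
  assumes f: "computable f"
  shows "computable_pred (\<lambda>x. code_ok (f x))" "computable (\<lambda>x. code_gates (f x))"
    "computable_pred (\<lambda>x. code_manifests (f x))"
proof -
  have "computable_pred code_ok"
    unfolding code_ok_def[abs_def] by (intro computable_intros)
  from computable_pred_comp[OF this f] show "computable_pred (\<lambda>x. code_ok (f x))" .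
  have "computable code_gates"
    unfolding code_gates_def[abs_def] by (intro computable_intros)
  from computable_comp[OF this f] show "computable (\<lambda>x. code_gates (f x))" .
  have "computable_pred code_manifests"
    unfolding code_manifests_def[abs_def] code_state_def by (intro computable_intros)
  from computable_pred_comp[OF this f] show "computable_pred (\<lambda>x. code_manifests (f x))" .
qed

lemma inj_rsys_code: "inj rsys_code"
proof (rule injI)
  fix s t assume eq: "rsys_code s = rsys_code t"
  have "inj (of_bool :: bool \<Rightarrow> nat)" by (auto simp: inj_def)
  with eq show "s = t"
    by (cases s; cases t) (auto simp: rsys_code_def list_encode_eq inj_rexpr_code)
qed

lemma ex_map_of_ball:
  "\<forall>y\<in>set ys. \<exists>x. y = f x \<and> P x \<Longrightarrow> \<exists>xs. ys = map f xs \<and> (\<forall>x\<in>set xs. P x)"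
proof (induction ys)
  case (Cons y ys)
  then obtain x xs where "y = f x" "P x" "ys = map f xs" "\<forall>x\<in>set xs. P x" by auto
  then have "y # ys = map f (x # xs) \<and> (\<forall>x\<in>set (x # xs). P x)" by simp
  then show ?case by (rule exI)
qed simp

lemma code_ok_iff: "code_ok x \<longleftrightarrow> (\<exists>s. rsys_wf s \<and> x = rsys_code s)"
proof
  assume ok: "code_ok x"
  obtain us where us: "pfst x = list_encode us" by (metis list_decode_inverse)
  obtain is' where is': "pfst (psnd x) = list_encode is'" by (metis list_decode_inverse)
  let ?o = "psnd (psnd x)"
  have len: "length is' = length us" "?o < length us"
    and u: "\<forall>y\<in>set us. \<exists>e. y = rexpr_code e \<and> (\<forall>i\<in>rexpr_vars e. i < length us)"
    and i: "\<forall>y\<in>set is'. y \<le> 1"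
    using ok unfolding code_ok_def us is' list_len_encode exprs_ok_encode bits_ok_encode
      of_bool_eq_1_iff by blast+
  have "\<exists>es. us = map rexpr_code es \<and> (\<forall>e\<in>set es. \<forall>i\<in>rexpr_vars e. i < length us)"
    using u by (rule ex_map_of_ball)
  then obtain es where es: "us = map rexpr_code es" "\<forall>e\<in>set es. \<forall>i\<in>rexpr_vars e. i < length us"
    by blast
  have "map of_bool (map (\<lambda>y. y = 1) is') = is'"
    using i by (auto intro!: map_idI simp: le_Suc_eq)
  then obtain bs where bs: "is' = map of_bool bs" by metis
  have "x = rsys_code (RSys es bs ?o)"
    by (simp add: rsys_code_def flip: es(1) bs us is')
  moreover have "rsys_wf (RSys es bs ?o)"
    using len es bs by (simp add: rsys_wf_def)
  ultimately show "\<exists>s. rsys_wf s \<and> x = rsys_code s" by blast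
next
  assume "\<exists>s. rsys_wf s \<and> x = rsys_code s"
  then show "code_ok x"
    by (fastforce simp: code_ok_def rsys_code_def rsys_wf_def list_len_encode exprs_ok_encode
        bits_ok_encode)
qed

lemma rsys_gates_less: "q \<in> rsys_gates s \<Longrightarrow> q < rsys_code s"
proof -
  assume "q \<in> rsys_gates s"
  then obtain e where e: "e \<in> set (updates s)" "q \<in> rexpr_gates e" by (auto simp: rsys_gates_def)
  from rexpr_gates_less[OF e(2)] have "q < rexpr_code e" .
  also have "\<dots> < list_encode (map rexpr_code (updates s))" using e(1) by (intro less_list_encode) simp
  also have "\<dots> \<le> rsys_code s" unfolding rsys_code_def by (rule le_prod_encode_1)
  finally show ?thesis .
qed

lemma finite_rsys_gates: "finite (rsys_gates s)"
  by (rule finite_subset[of _ "{..<rsys_code s}"]) (auto dest: rsys_gates_less)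

lemma code_gates: "code_gates (rsys_code s) = set_encode (rsys_gates s)"
proof -
  have "{q. q < rsys_code s \<and> exprs_gate q (pfst (rsys_code s)) = 1} = rsys_gates s"
    using rsys_gates_less[of _ s]
    by (auto simp: rsys_code_def exprs_gate_encode rsys_gates_def)
  then show ?thesis by (simp add: code_gates_def)
qed

lemma code_fill:
  "code_fill (rsys_code s) A = rsys_code (rsys_fill s (\<lambda>q. q \<in> set_decode A))"
  by (simp add: code_fill_def rsys_code_def rsys_fill_def exprs_subst_encode)

lemma length_rsys_state: "rsys_wf s \<Longrightarrow> length (rsys_state s t) = length (updates s)"
  by (cases t) (auto simp: rsys_wf_def)

lemma code_state:
  assumes "rsys_wf s"
  shows "code_state (rsys_code s) t = list_encode (map of_bool (rsys_state s t))"
proof (induction t)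
  case 0
  then show ?case by (simp add: code_state_def rsys_code_def)
next
  case (Suc t)
  have "code_state (rsys_code s) (Suc t) =
      exprs_value (code_state (rsys_code s) t) (list_encode (map rexpr_code (updates s)))"
    by (simp add: code_state_def rsys_code_def)
  also have "\<dots> = list_encode (map of_bool (rsys_state s (Suc t)))"
    using exprs_value_encode[of "updates s" "rsys_state s t"] assms
    by (simp add: Suc length_rsys_state rsys_wf_def)
  finally show ?case .
qed

lemma code_manifests:
  assumes wf: "rsys_wf s"
  shows "code_manifests (rsys_code s) \<longleftrightarrow> rsys_manifests s"
proof -
  let ?n = "length (updates s)" and ?o = "observed s"
  let ?X = "{xs :: bool list. set xs \<subseteq> UNIV \<and> length xs = ?n}"
  have X: "finite ?X" "card ?X = 2 ^ ?n"
    using finite_lists_length_eq[of "UNIV :: bool set" ?n] card_lists_length_eq[of "UNIV :: bool set" ?n]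
    by simp_all
  obtain T P where TP: "P > 0" "T + P \<le> 2 ^ ?n" "\<forall>t\<ge>T. rsys_state s (t + P) = rsys_state s t"
    using recurrence_of_finite[of "rsys_state s" ?X] X length_rsys_state[OF wf] by auto
  have "\<exists>t'<2 ^ ?n. rsys_state s t' = rsys_state s t" for t
  proof (induction t rule: less_induct)
    case (less t)
    show ?case
    proof (cases "t < 2 ^ ?n")
      case False
      \<comment> \<open>Going back by one period stays in the periodic part because
        \<open>T + P\<close> is at most \<open>2 ^ ?n\<close>.\<close>
      then have "t - P < t" "t - P \<ge> T" "t - P + P = t" using TP(1,2) by auto
      with less[of "t - P"] TP(3) show ?thesis by metis
    qed blast
  qed
  then have "rsys_manifests s \<longleftrightarrow> (\<exists>t<2 ^ ?n. rsys_state s t ! ?o)"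
    unfolding rsys_manifests_def by metis
  moreover have "lnth (code_state (rsys_code s) t) ?o = of_bool (rsys_state s t ! ?o)" for t
    using wf length_rsys_state[OF wf, of t]
    by (simp add: code_state lnth_list_encode rsys_wf_def)
  moreover have "list_len (pfst (rsys_code s)) = ?n" "psnd (psnd (rsys_code s)) = ?o"
    by (simp_all add: rsys_code_def list_len_encode)
  ultimately show ?thesis unfolding code_manifests_def by (simp only: of_bool_eq_1_iff)
qed

lemma code_ok_rsys_code: "code_ok (rsys_code s) \<longleftrightarrow> rsys_wf s"
  unfolding code_ok_iff using inj_rsys_code by (auto dest: injD)

lemma rsys_wf_fill: "rsys_wf s \<Longrightarrow> rsys_wf (rsys_fill s \<alpha>)"
proof -
  have "rexpr_vars (rexpr_fill \<alpha> e) = rexpr_vars e" for e by (induction e) auto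
  then show "rsys_wf s \<Longrightarrow> rsys_wf (rsys_fill s \<alpha>)" by (simp add: rsys_wf_def rsys_fill_def)
qed

lemma rsys_gates_fill: "rsys_gates (rsys_fill s \<alpha>) = {}"
proof -
  have "rexpr_gates (rexpr_fill \<alpha> e) = {}" for e by (induction e) auto
  then show ?thesis by (simp add: rsys_gates_def rsys_fill_def)
qed

lemma rsys_fill_cong:
  assumes "\<And>q. q \<in> rsys_gates s \<Longrightarrow> \<alpha> q = \<beta> q"
  shows "rsys_fill s \<alpha> = rsys_fill s \<beta>"
proof -
  have "rexpr_fill \<alpha> e = rexpr_fill \<beta> e" if "\<And>q. q \<in> rexpr_gates e \<Longrightarrow> \<alpha> q = \<beta> q" for e
    using that by (induction e) auto
  then show ?thesis using assms by (auto simp: rsys_fill_def rsys_gates_def)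
qed

lemma rsys_fill_gate_free: "rsys_gates s = {} \<Longrightarrow> rsys_fill s \<alpha> = s"
proof -
  have "rexpr_fill \<alpha> e = e" if "rexpr_gates e = {}" for e using that by (induction e) auto
  then show "rsys_gates s = {} \<Longrightarrow> rsys_fill s \<alpha> = s"
    by (cases s) (auto simp: rsys_fill_def rsys_gates_def intro: map_idI)
qed

lemma code_gates_eq_0_iff: "code_gates (rsys_code s) = 0 \<longleftrightarrow> rsys_gates s = {}"
  using set_encode_eq[OF finite_rsys_gates finite.emptyI] by (simp add: code_gates)

lemma decidable_domain_reentry:
  assumes \<mu>: "computable_numbering rsys_code {s. rsys_wf s \<and> rsys_gates s = {}} \<mu>"
    and \<nu>: "computable_numbering rsys_code {s. rsys_wf s} \<nu>"
    and ext: "extends_numbering \<nu> \<mu>"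
  shows "decidable_domain (reentry \<mu> \<nu>)"
proof -
  have wf: "x \<in> rsys_code ` {s. rsys_wf s} \<longleftrightarrow> code_ok x" for x
    by (auto simp: code_ok_iff)
  have man: "x \<in> rsys_code ` {s. (rsys_wf s \<and> rsys_gates s = {}) \<and> rsys_manifests s} \<longleftrightarrow>
      code_ok x \<and> code_gates x = 0 \<and> code_manifests x" for x
    unfolding code_ok_iff using code_gates_eq_0_iff code_manifests by auto
  have "presentation (reentry \<mu> \<nu>)"
    unfolding presentation_def
  proof (intro conjI)
    show "inj_on (goedel (reentry \<mu> \<nu>)) (sysp (reentry \<mu> \<nu>))"
      by (simp add: reentry_def inj_on_subset[OF inj_rsys_code])
    show "decidable_set (goedel (reentry \<mu> \<nu>) ` sysp (reentry \<mu> \<nu>))"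
      unfolding decidable_set_iff reentry_def domain_pres.simps wf by (intro computable_intros)
    show "\<exists>g. computable g \<and> (\<forall>s\<in>sysp (reentry \<mu> \<nu>).
        g (goedel (reentry \<mu> \<nu>) s) = set_encode (gates (reentry \<mu> \<nu>) s))"
      by (rule exI[of _ "\<lambda>x. code_gates x"]) (auto simp: reentry_def code_gates intro: computable_intros)
    show "\<exists>h. computable h \<and> (\<forall>s\<in>sysp (reentry \<mu> \<nu>). \<forall>A. finite A \<longrightarrow>
        h (prod_encode (goedel (reentry \<mu> \<nu>) s, set_encode A)) =
        goedel (reentry \<mu> \<nu>) (fill (reentry \<mu> \<nu>) s (\<lambda>q. q \<in> A)))"
      by (rule exI[of _ "\<lambda>z. code_fill (pfst z) (psnd z)"])
        (auto simp: reentry_def code_fill intro!: computable_intros)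
  qed (use \<mu> \<nu> ext in \<open>auto simp: reentry_def finite_rsys_gates rsys_wf_fill rsys_gates_fill
      rsys_fill_gate_free intro: rsys_fill_cong\<close>)
  moreover have "decidable_set (goedel (reentry \<mu> \<nu>) `
      {s \<in> sys (reentry \<mu> \<nu>). manifests (reentry \<mu> \<nu>) s})"
    unfolding decidable_set_iff reentry_def domain_pres.simps mem_Collect_eq man
    by (intro computable_intros)
  ultimately show ?thesis by (simp add: decidable_domain_def)
qed

section \<open>Counters with end-around carry\<close>

text \<open>
  The index of the system for bit \<open>i\<close> of the \<open>n\<close>-bit counter.  Reserving the odd indices of the
  numbering for the counters lets these systems refer to each other without a recursion theorem.
\<close>

definition node :: "nat \<Rightarrow> nat \<Rightarrow> nat" where
  "node n i = Suc (2 * prod_encode (n, i))"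

text \<open>Bit \<open>j\<close> receives a carry iff all lower bits are mark. Juxtaposition is
  disjunction, so the negation is the natural expression: some lower bit is void.\<close>

primrec no_carry :: "nat \<Rightarrow> nat \<Rightarrow> rexpr" where
  "no_carry n 0 = Void"
| "no_carry n (Suc j) = Juxt (Cross (Ask (node n j))) (no_carry n j)"

text \<open>
  Since the iteration negates, these are the negations of the next bits of a counter with end-around
  carry, whose successor of \<open>2 ^ n - 1\<close> is \<open>1\<close>.
\<close>

definition counter_expr :: "nat \<Rightarrow> nat \<Rightarrow> rexpr" where
  "counter_expr n j =
     (if j = 0 then Cross (Juxt (Cross (Ask (node n 0))) (Cross (no_carry n n)))
      else Juxt (Cross (Juxt (Cross (Ask (node n j))) (no_carry n j)))
             (Cross (Juxt (Ask (node n j)) (Cross (no_carry n j)))))"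

text \<open>The single variable starts void and its update never reads it, so the system manifests
  exactly if the filled expression evaluates to mark.\<close>

definition counter_sys :: "nat \<Rightarrow> nat \<Rightarrow> rsystem" where
  "counter_sys n j = RSys [counter_expr n j] [False] 0"

lemma rexpr_vars_no_carry: "rexpr_vars (no_carry n j) = {}"
  by (induction j) auto

lemma rexpr_gates_no_carry: "rexpr_gates (no_carry n j) = node n ` {..<j}"
  by (induction j) (auto simp: lessThan_Suc)

lemma rsys_wf_counter_sys: "rsys_wf (counter_sys n j)"
  by (auto simp: rsys_wf_def counter_sys_def counter_expr_def rexpr_vars_no_carry)

lemma rsys_gates_counter_sys:
  "rsys_gates (counter_sys n j) = node n ` (if j = 0 then insert 0 {..<n} else {..j})"
  by (auto simp: rsys_gates_def counter_sys_def counter_expr_def rexpr_gates_no_carry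
      lessThan_Suc_atMost[symmetric] lessThan_Suc)

lemma rexpr_eval_no_carry:
  "rexpr_eval \<sigma> (rexpr_fill \<alpha> (no_carry n j)) \<longleftrightarrow> (\<exists>i<j. \<not> \<alpha> (node n i))"
  by (induction j) (auto simp: less_Suc_eq)

text \<open>Bit 0 flips at every step, except that it stays mark when all bits are mark; this
  exception is the end-around carry. Every other bit is the exclusive or of itself and its
  carry.\<close>

lemma rsys_manifests_counter_sys:
  "rsys_manifests (rsys_fill (counter_sys n j) \<alpha>) \<longleftrightarrow>
     \<not> (if j = 0 then \<alpha> (node n 0) \<longrightarrow> (\<forall>i<n. \<alpha> (node n i))
        else \<alpha> (node n j) \<noteq> (\<forall>i<j. \<alpha> (node n i)))"
proof -
  define s where "s = rsys_fill (counter_sys n j) \<alpha>"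
  define v where "v = rexpr_eval (\<lambda>_. False) (rexpr_fill \<alpha> (counter_expr n j))"
  have no_vars: "rexpr_eval \<sigma> (rexpr_fill \<alpha> (counter_expr n j)) = v" for \<sigma>
    by (simp add: v_def counter_expr_def rexpr_eval_no_carry)
  have "rsys_state s t ! observed s \<longleftrightarrow> t > 0 \<and> v" for t
    by (cases t) (simp_all add: s_def rsys_fill_def counter_sys_def no_vars)
  then have "rsys_manifests s \<longleftrightarrow> v" by (auto simp: rsys_manifests_def)
  then show ?thesis unfolding s_def v_def by (auto simp: counter_expr_def rexpr_eval_no_carry)
qed

section \<open>Numberings that contain the counters\<close>

definition void_sys :: rsystem where
  "void_sys = RSys [Void] [False] 0"

definition num_re :: "nat \<Rightarrow> rsystem" where
  "num_re i = (if code_ok i \<and> code_gates i = 0 then inv rsys_code i else void_sys)"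

text \<open>The even indices already exhaust the language, with \<open>void_sys\<close> at
  non-codes, so the odd ones are free for the counters.\<close>

definition nump_re :: "nat \<Rightarrow> rsystem" where
  "nump_re i =
     (if odd i then counter_sys (pfst (i div 2)) (psnd (i div 2))
      else if code_ok (i div 2) then inv rsys_code (i div 2) else void_sys)"

lemma void_sys: "rsys_wf void_sys" "rsys_gates void_sys = {}"
  by (auto simp: void_sys_def rsys_wf_def rsys_gates_def)

lemma code_ok_inv:
  assumes "code_ok x" shows "rsys_wf (inv rsys_code x)" "rsys_code (inv rsys_code x) = x"
  using assms inj_rsys_code by (auto simp: code_ok_iff)

text \<open>Only the code of the numbered system has to be computed, and on valid codes
  \<open>rsys_code\<close> cancels \<open>inv rsys_code\<close>.\<close>

lemma computable_num_re: "computable (\<lambda>i. rsys_code (num_re i))"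
proof -
  have "computable (\<lambda>i. if code_ok i \<and> code_gates i = 0 then i else rsys_code void_sys)"
    by (intro computable_intros)
  moreover have "rsys_code (num_re i) =
      (if code_ok i \<and> code_gates i = 0 then i else rsys_code void_sys)" for i
    by (simp add: num_re_def code_ok_inv)
  ultimately show ?thesis by simp
qed

lemma range_num_re: "range num_re = {s. rsys_wf s \<and> rsys_gates s = {}}"
proof
  have "rsys_wf (num_re i) \<and> rsys_gates (num_re i) = {}" for i
    using code_gates_eq_0_iff[of "inv rsys_code i"] code_ok_inv[of i] void_sys
    by (auto simp: num_re_def)
  then show "range num_re \<subseteq> {s. rsys_wf s \<and> rsys_gates s = {}}" by blast
  have "s = num_re (rsys_code s)" if "rsys_wf s" "rsys_gates s = {}" for s
    using that by (simp add: num_re_def code_ok_rsys_code code_gates_eq_0_iff inj_rsys_code)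
  then show "{s. rsys_wf s \<and> rsys_gates s = {}} \<subseteq> range num_re" by blast
qed

lemma range_nump_re: "range nump_re = {s. rsys_wf s}"
proof
  show "range nump_re \<subseteq> {s. rsys_wf s}"
    by (auto simp: nump_re_def code_ok_inv void_sys rsys_wf_counter_sys)
  have "s = nump_re (2 * rsys_code s)" if "rsys_wf s" for s
    using that by (simp add: nump_re_def code_ok_rsys_code inj_rsys_code)
  then show "{s. rsys_wf s} \<subseteq> range nump_re" by blast
qed

lemma computable_node: "computable f \<Longrightarrow> computable g \<Longrightarrow> computable (\<lambda>x. node (f x) (g x))"
  unfolding node_def by (intro computable_intros)

lemma computable_no_carry:
  assumes f: "computable f" and g: "computable g"
  shows "computable (\<lambda>x. rexpr_code (no_carry (f x) (g x)))"
proof -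
  have "rexpr_code (no_carry n j) = rec_nat (rexpr_code Void) (\<lambda>j r. prod_encode (3,
      prod_encode (prod_encode (2, prod_encode (4, node n j)), r))) j" for n j
    by (induction j) auto
  then show ?thesis
    by (simp only:) (intro computable_intros computable_node f g computable_comp[OF f])
qed

lemma computable_nump_re: "computable (\<lambda>i. rsys_code (nump_re i))"
proof -
  have expr: "computable (\<lambda>x. rexpr_code (counter_expr (f x) (g x)))"
    if "computable f" "computable g" for f g
    unfolding counter_expr_def if_distrib[of rexpr_code] rexpr_code.simps
    by (intro computable_intros computable_node computable_no_carry that)
  \<comment> \<open>\<open>Suc (prod_encode (e, 0))\<close> is the code of the one-element list of
    updates.\<close>
  have "computable (\<lambda>i. if odd i
      then prod_encode (Suc (prod_encode (rexpr_code (counter_expr (pfst (i div 2)) (psnd (i div 2))), 0)),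
        prod_encode (list_encode [0], 0))
      else if code_ok (i div 2) then i div 2 else rsys_code void_sys)"
    by (intro computable_intros expr)
  moreover have "rsys_code (nump_re i) = (if odd i
      then prod_encode (Suc (prod_encode (rexpr_code (counter_expr (pfst (i div 2)) (psnd (i div 2))), 0)),
        prod_encode (list_encode [0], 0))
      else if code_ok (i div 2) then i div 2 else rsys_code void_sys)" for i
    by (simp add: nump_re_def code_ok_inv counter_sys_def rsys_code_def[of "RSys _ _ _"])
  ultimately show ?thesis by simp
qed

lemma extends_nump_re: "extends_numbering nump_re num_re"
proof -
  have "nump_re (2 * rsys_code (num_re i)) = num_re i" for i
  proof -
    have "rsys_wf (num_re i)" using range_num_re by blast
    then show ?thesis by (simp add: nump_re_def code_ok_rsys_code inj_rsys_code)
  qed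
  moreover have "computable (\<lambda>i. 2 * rsys_code (num_re i))"
    by (intro computable_intros computable_num_re)
  ultimately show ?thesis unfolding extends_numbering_def by blast
qed

lemma decidable_domain_re: "decidable_domain (reentry num_re nump_re)"
  by (intro decidable_domain_reentry)
    (simp_all add: computable_numbering_def range_num_re range_nump_re computable_num_re
      computable_nump_re extends_nump_re)

section \<open>Binary counting and the period of the counter systems\<close>

text \<open>Incrementing an even number touches only bit 0; for an odd one the carry increments
  \<open>m div 2\<close>, which is the induction hypothesis at a different number.\<close>

lemma bit_Suc_iff: "bit (Suc m) j \<longleftrightarrow> bit m j \<noteq> (\<forall>i<j. bit m i)"
proof (induction j arbitrary: m)
  case 0
  then show ?case by (simp add: bit_0)
next
  case (Suc j)
  have "(\<forall>i<Suc j. bit m i) \<longleftrightarrow> odd m \<and> (\<forall>i<j. bit (m div 2) i)"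
    by (simp add: All_less_Suc2 bit_0 bit_Suc)
  then show ?case
    using Suc.IH[of "m div 2"] by (cases "odd m") (simp_all add: bit_Suc)
qed

lemma all_bits_iff:
  "m < 2 ^ n \<Longrightarrow> (\<forall>i<n. bit m i) \<longleftrightarrow> m = 2 ^ n - (1::nat)"
proof (induction n arbitrary: m)
  case (Suc n)
  have "(\<forall>i<Suc n. bit m i) \<longleftrightarrow> odd m \<and> (\<forall>i<n. bit (m div 2) i)"
    by (simp add: All_less_Suc2 bit_0 bit_Suc)
  also have "\<dots> \<longleftrightarrow> odd m \<and> m div 2 = 2 ^ n - 1"
    using Suc by auto
  also have "\<dots> \<longleftrightarrow> m = 2 ^ Suc n - 1"
  proof -
    obtain k where "(2::nat) ^ n = Suc k" by (metis gr0_implies_Suc zero_less_numeral zero_less_power)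
    then show ?thesis by (auto elim!: oddE)
  qed
  finally show ?case .
qed simp

primrec counter :: "nat \<Rightarrow> nat \<Rightarrow> nat" where
  "counter n 0 = 0"
| "counter n (Suc k) = (if counter n k = 2 ^ n - 1 then 1 else Suc (counter n k))"

lemma counter_less: "n > 0 \<Longrightarrow> counter n k < 2 ^ n"
proof (induction k)
  case (Suc k)
  moreover have "(1::nat) < 2 ^ n" using Suc.prems one_less_power[of "2::nat" n] by simp
  ultimately show ?case by auto
qed simp

text \<open>The value 0 is taken only at time 0; afterwards the counter cycles through the nonzero
  values, whence both occurrences of \<open>Suc\<close>.\<close>

lemma counter_Suc:
  assumes "n > 0" shows "counter n (Suc r) = Suc (r mod (2 ^ n - 1))"
proof (induction r)
  case 0
  have "(1::nat) < 2 ^ n" using assms one_less_power[of "2::nat" n] by simp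
  then show ?case by simp
next
  case (Suc r)
  have M: "(1::nat) < 2 ^ n" using assms one_less_power[of "2::nat" n] by simp
  have "counter n (Suc (Suc r)) =
      (if Suc (r mod (2 ^ n - 1)) = 2 ^ n - 1 then 1 else Suc (Suc (r mod (2 ^ n - 1))))"
    using Suc by (subst counter.simps) simp
  then show ?case by (simp add: mod_Suc)
qed

lemma reentry_sel:
  "manifests (reentry \<mu> \<nu>) = rsys_manifests" "fill (reentry \<mu> \<nu>) = rsys_fill"
  "nump (reentry \<mu> \<nu>) = \<nu>" "gates (reentry \<mu> \<nu>) = rsys_gates"
  by (simp_all add: reentry_def)

lemma iterate_node:
  assumes "n > 0" "j < n"
  shows "iterate (reentry num_re nump_re) k (node n j) \<longleftrightarrow> bit (counter n k) j"
  using assms(2)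
proof (induction k arbitrary: j)
  case 0
  then show ?case by simp
next
  case (Suc k)
  let ?D = "reentry num_re nump_re" and ?m = "counter n k"
  have "nump_re (node n j) = counter_sys n j" by (simp add: nump_re_def node_def)
  then have "iterate ?D (Suc k) (node n j) \<longleftrightarrow>
      (if j = 0 then bit ?m 0 \<longrightarrow> (\<forall>i<n. bit ?m i) else bit ?m j \<noteq> (\<forall>i<j. bit ?m i))"
    using Suc assms(1)
    by (simp add: reentry_sel rsys_manifests_counter_sys)
  also have "\<dots> \<longleftrightarrow> bit (counter n (Suc k)) j"
  proof (cases "?m = 2 ^ n - 1")
    \<comment> \<open>In the all-mark state bit 0 stays mark and every other bit is cleared by its
      carry, which leaves the binary form of 1.\<close>
    case True
    then have "\<forall>i<n. bit ?m i" using all_bits_iff counter_less assms(1) by blast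
    then show ?thesis using True Suc.prems by (auto simp: bit_Suc_0_iff)
  next
    case False
    then have "\<not> (\<forall>i<n. bit ?m i)" using all_bits_iff counter_less assms(1) by blast
    then show ?thesis using False by (auto simp: bit_Suc_iff)
  qed
  finally show ?case .
qed

text \<open>The top bit asks every bit, itself included, so one step from it reaches the whole
  counter, and no counter system asks outside.\<close>

lemma asks_closure_node:
  assumes "n > 0"
  shows "asks_closure (reentry num_re nump_re) (node n (n - 1)) = node n ` {..<n}"
proof -
  let ?D = "reentry num_re nump_re"
  have asks: "asks ?D (node n j) = node n ` (if j = 0 then insert 0 {..<n} else {..j})" for j
    by (simp add: asks_def reentry_sel nump_re_def node_def[of n j] rsys_gates_counter_sys)
  have "q \<in> node n ` {..<n}" if "q \<in> asks_closure ?D (node n (n - 1))" for q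
    using that
  proof induction
    case (step q r)
    then show ?case using assms asks by (auto split: if_splits)
  qed (use assms in simp)
  moreover have "node n i \<in> asks ?D (node n (n - 1))" if "i < n" for i
    using that by (auto simp: asks)
  ultimately show ?thesis
    using asks_closure.step[OF asks_closure.base, of _ ?D "node n (n - 1)"] by blast
qed

lemma bit_top_iff:
  assumes "n > 0" "m < 2 ^ n" shows "bit m (n - 1) \<longleftrightarrow> 2 ^ (n - 1) \<le> (m :: nat)"
proof -
  have "m div 2 ^ (n - 1) < 2"
    using assms by (simp add: div_less_iff_less_mult flip: power_Suc)
  then have "odd (m div 2 ^ (n - 1)) \<longleftrightarrow> m div 2 ^ (n - 1) > 0"
    by (auto dest: less_2_cases)
  then show ?thesis by (simp add: bit_iff_odd div_greater_zero_iff)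
qed

text \<open>In one round the counter runs from 1 to \<open>M = 2 * h - 1\<close>, and its top bit is
  void below \<open>h\<close> and mark from \<open>h\<close> on. A positive shift
  \<open>Q < M\<close> moves some mark onto a void.\<close>

lemma eventual_period_node:
  assumes n: "n > 0"
  defines "x \<equiv> \<lambda>k. iterate (reentry num_re nump_re) k (node n (n - 1))"
  shows "eventually_periodic x" "eventual_period x = 2 ^ n - 1"
proof -
  define h M :: nat where "h = 2 ^ (n - 1)" and "M = 2 ^ n - 1"
  have "(2::nat) ^ n = 2 * 2 ^ (n - 1)" using n by (cases n) auto
  then have h: "h > 0" "M + 1 = 2 * h" by (simp_all add: h_def M_def)
  have x: "x (Suc r) \<longleftrightarrow> h \<le> Suc (r mod M)" for r
    using iterate_node[of n "n - 1" "Suc r"] bit_top_iff[OF n counter_less[OF n, of "Suc r"]] n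
    by (simp add: x_def counter_Suc h_def M_def del: iterate.simps counter.simps)
  have M: "M > 0" using h by linarith
  have per: "x (k + M) = x k" if "k \<ge> 1" for k using that x by (cases k) auto
  have M_per: "is_eventual_period x M" using M per unfolding is_eventual_period_def by blast
  then show "eventually_periodic x" by (auto simp: eventually_periodic_def)
  have "M \<le> Q" if Q: "is_eventual_period x Q" for Q
  proof (rule ccontr)
    assume "\<not> M \<le> Q"
    then have less: "Q < M" by simp
    have "Q > 0" using Q by (simp add: is_eventual_period_def)
    have shift: "x (Suc r + Q) = x (Suc r)" for r
      by (rule eventual_period_shift[of M 1 x Q, OF M per Q]) auto
    show False
    proof (cases "Q \<le> h")
      case True
      \<comment> \<open>The time \<open>Suc (M - Q)\<close> lies \<open>Q\<close> steps before the
        next round starts: the counter shows \<open>2 * h - Q\<close>, a mark, and the shift lands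
        on the value 1, a void.\<close>
      then have "h \<le> Suc ((M - Q) mod M)" using h \<open>Q > 0\<close> less by simp
      then have "x (Suc (M - Q))" by (simp add: x)
      then have "x (Suc M)" using shift[of "M - Q"] less by simp
      then show False using h True less \<open>Q > 0\<close> by (simp add: x)
    next
      case False
      \<comment> \<open>A shift beyond \<open>h\<close> carries the first mark, at counter value
        \<open>h\<close>, over the \<open>h\<close> marks of its block to the value
        \<open>Suc (Q - h)\<close> of the next round, which is below \<open>h\<close>.\<close>
      have "x (Suc (h - 1))" by (subst x) (use h less in simp)
      then have "x (Suc (h - 1) + Q)" by (simp only: shift)
      moreover have "Suc (h - 1) + Q = Suc (Q - h + M)" using h False by simp
      ultimately have "x (Suc (Q - h + M))" by simp
      then have "h \<le> Suc (Q - h)" using less by (simp add: x)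
      then show False using h less False by simp
    qed
  qed
  then show "eventual_period x = 2 ^ n - 1"
    unfolding eventual_period_def M_def[symmetric] using M_per by (intro Least_equality)
qed

theorem theorem5p3:
  fixes D :: "'s domain_pres"
  shows
    "(decidable_domain D \<longrightarrow>
        (\<forall>p n. finite (asks_closure D p) \<and> card (asks_closure D p) = n \<longrightarrow>
           eventually_periodic (\<lambda>k. iterate D k p) \<and>
           transient (\<lambda>k. iterate D k p) + eventual_period (\<lambda>k. iterate D k p) \<le> 2 ^ n) \<and>
        (\<exists>f. partrec f \<and>
           (\<forall>p. finite (asks_closure D p) \<longrightarrow>
              f (goedel D (nump D p)) = Some (eventual_period (\<lambda>k. iterate D k p))))) \<and>
     (\<exists>\<mu> \<nu>. decidable_domain (reentry \<mu> \<nu>) \<and>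
        infinite {n. \<exists>p. finite (asks_closure (reentry \<mu> \<nu>) p) \<and>
          card (asks_closure (reentry \<mu> \<nu>) p) = n \<and>
          eventually_periodic (\<lambda>k. iterate (reentry \<mu> \<nu>) k p) \<and>
          eventual_period (\<lambda>k. iterate (reentry \<mu> \<nu>) k p) = 2 ^ n - 1})"
proof -
  let ?D = "reentry num_re nump_re"
  let ?N = "{n. \<exists>p. finite (asks_closure ?D p) \<and> card (asks_closure ?D p) = n \<and>
      eventually_periodic (\<lambda>k. iterate ?D k p) \<and>
      eventual_period (\<lambda>k. iterate ?D k p) = 2 ^ n - 1}"
  have "n \<in> ?N" if "n > 0" for n
  proof -
    have "card (node n ` {..<n}) = n"
      by (subst card_image) (auto simp: inj_on_def node_def prod_encode_eq)
    then have "finite (asks_closure ?D (node n (n - 1))) \<and> card (asks_closure ?D (node n (n - 1))) = n \<and>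
        eventually_periodic (\<lambda>k. iterate ?D k (node n (n - 1))) \<and>
        eventual_period (\<lambda>k. iterate ?D k (node n (n - 1))) = 2 ^ n - 1"
      using eventual_period_node[OF that] asks_closure_node[OF that] by simp
    then show ?thesis by blast
  qed
  then have "{0<..} \<subseteq> ?N" by auto
  then have "infinite ?N" using infinite_Ioi finite_subset by blast
  with decidable_domain_re have "\<exists>\<mu> \<nu>. decidable_domain (reentry \<mu> \<nu>) \<and>
      infinite {n. \<exists>p. finite (asks_closure (reentry \<mu> \<nu>) p) \<and>
        card (asks_closure (reentry \<mu> \<nu>) p) = n \<and>
        eventually_periodic (\<lambda>k. iterate (reentry \<mu> \<nu>) k p) \<and>
        eventual_period (\<lambda>k. iterate (reentry \<mu> \<nu>) k p) = 2 ^ n - 1}"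
    by blast
  moreover have "eventually_periodic (\<lambda>k. iterate D k p) \<and>
      transient (\<lambda>k. iterate D k p) + eventual_period (\<lambda>k. iterate D k p) \<le> 2 ^ n"
    if "decidable_domain D" "finite (asks_closure D p) \<and> card (asks_closure D p) = n" for p n
    using that iterate_eventually_periodic[of D p] by (auto simp: decidable_domain_def)
  ultimately show ?thesis using eventual_period_partrec[of D] by blast
qed

end
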